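(* Let $n\geq 4$, let $(M^{2n},J)$ be a connected, simply connected Kaehler manifold of complex dimension $n$ that is free of flat points, and let $f\colon M^{2n}\to\mathbb{R}^{2n+1}$ be a conformal immersion. Then $f$ is conformally congruent to a real Kaehler hypersurface, that is, there exist an isometric immersion $g\colon M^{2n}\to\mathbb{R}^{2n+1}$ (with respect to the given Kaehler metric on $M^{2n}$) and a conformal (Moebius) transformation $\tau$ of $\mathbb{R}^{2n+1}$ such that $g=\tau\circ f$.
   Context: All manifolds and maps are smooth; $M^{2n}$ has real dimension $2n$ and carries its Kaehler metric $\langle\,,\,\rangle_M$. An immersion $f\colon M^{2n}\to\mathbb{R}^{2n+\ell}$ is conformal if there is a positive function $\lambda\in C^\infty(M)$ such that the metric induced by $f$ is $\lambda^2\langle\,,\,\rangle_M$. It is called a real Kaehler submanifold if $\lambda\equiv 1$ (i.e. $f$ is an isometric immersion of the Kaehler manifold). A real Kaehler hypersurface is a real Kaehler submanifold of codimension one of a Kaehler manifold free of flat points. A flat point is a point at which the curvature tensor of the Kaehler metric vanishes. Two immersions $f,g\colon M\to\mathbb{R}^N$ are conformally congruent if $g=\tau\circ f$ for some conformal (Moebius) transformation $\tau$ of $\mathbb{R}^N$; as usual a Moebius transformation may fail to be defined at one point of $\mathbb{R}^N$, and it is required that $\tau$ be defined on $f(M)$. *)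

theory Defs
  imports "HOL-Analysis.Analysis"
begin

section \<open>Smooth maps on open subsets of Euclidean space\<close>

primrec continuously_differentiable ::
    "nat \<Rightarrow> 'a::euclidean_space set \<Rightarrow> ('a \<Rightarrow> 'b::real_normed_vector) \<Rightarrow> bool" where
  "continuously_differentiable 0 S f \<longleftrightarrow> continuous_on S f"
| "continuously_differentiable (Suc k) S f \<longleftrightarrow>
     (\<forall>x\<in>S. f differentiable (at x)) \<and>
     (\<forall>v. continuously_differentiable k S (\<lambda>x. frechet_derivative f (at x) v))"

definition smooth_on :: "'a::euclidean_space set \<Rightarrow> ('a \<Rightarrow> 'b::real_normed_vector) \<Rightarrow> bool" where
  "smooth_on S f \<longleftrightarrow> (\<forall>k. continuously_differentiable k S f)"


section \<open>Smooth manifolds\<close>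

text \<open>A chart is a domain together with a coordinate map.  A manifold is given by an atlas;
  its underlying space is the union of the chart domains, an open subset of a second countable
  Hausdorff space.\<close>

type_synonym ('m, 'e) chart = "'m set \<times> ('m \<Rightarrow> 'e)"

definition chart_image :: "('m, 'e) chart \<Rightarrow> 'e set" where
  "chart_image c = snd c ` fst c"

definition chart_inv :: "('m, 'e) chart \<Rightarrow> 'e \<Rightarrow> 'm" where
  "chart_inv c = inv_into (fst c) (snd c)"

definition overlap :: "('m, 'e) chart \<Rightarrow> ('m, 'e) chart \<Rightarrow> 'e set" where
  "overlap c d = snd c ` (fst c \<inter> fst d)"

definition transition :: "('m, 'e) chart \<Rightarrow> ('m, 'e) chart \<Rightarrow> 'e \<Rightarrow> 'e" where
  "transition c d = snd d \<circ> chart_inv c"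

definition carrier :: "('m, 'e) chart set \<Rightarrow> 'm set" where
  "carrier A = (\<Union>c\<in>A. fst c)"

definition smooth_atlas ::
    "('m::{t2_space, second_countable_topology}, 'e::euclidean_space) chart set \<Rightarrow> bool" where
  "smooth_atlas A \<longleftrightarrow>
     (\<forall>c\<in>A. open (fst c) \<and> open (chart_image c) \<and>
        homeomorphism (fst c) (chart_image c) (snd c) (chart_inv c)) \<and>
     (\<forall>c\<in>A. \<forall>d\<in>A. smooth_on (overlap c d) (transition c d))"

definition smooth_map ::
    "('m, 'e::euclidean_space) chart set \<Rightarrow> ('m \<Rightarrow> 'v::real_normed_vector) \<Rightarrow> bool" where
  "smooth_map A f \<longleftrightarrow> (\<forall>c\<in>A. smooth_on (chart_image c) (f \<circ> chart_inv c))"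

definition differential ::
    "('m, 'e::euclidean_space) chart \<Rightarrow> ('m \<Rightarrow> 'v::real_normed_vector) \<Rightarrow> 'e \<Rightarrow> 'e \<Rightarrow> 'v" where
  "differential c f x = frechet_derivative (f \<circ> chart_inv c) (at x)"


section \<open>Riemannian metrics and almost complex structures\<close>

text \<open>A tensor field assigns to each chart its components in that chart, as a function of the
  coordinates of the point; components in overlapping charts are related by the derivative of the
  transition map.  The values at coordinates outside the image of the chart are irrelevant.\<close>

type_synonym ('m, 'e) metric_field = "('m, 'e) chart \<Rightarrow> 'e \<Rightarrow> 'e \<Rightarrow> 'e \<Rightarrow> real"
type_synonym ('m, 'e) endo_field = "('m, 'e) chart \<Rightarrow> 'e \<Rightarrow> 'e \<Rightarrow> 'e"

definition riemannian_metric ::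
    "('m, 'e::euclidean_space) chart set \<Rightarrow> ('m, 'e) metric_field \<Rightarrow> bool" where
  "riemannian_metric A G \<longleftrightarrow>
     (\<forall>c\<in>A. \<forall>x\<in>chart_image c. bilinear (G c x) \<and> (\<forall>u v. G c x u v = G c x v u) \<and>
        (\<forall>u. u \<noteq> 0 \<longrightarrow> G c x u u > 0)) \<and>
     (\<forall>c\<in>A. \<forall>u v. smooth_on (chart_image c) (\<lambda>x. G c x u v)) \<and>
     (\<forall>c\<in>A. \<forall>d\<in>A. \<forall>x\<in>overlap c d. \<forall>u v.
        G c x u v =
        G d (transition c d x) (frechet_derivative (transition c d) (at x) u)
                               (frechet_derivative (transition c d) (at x) v))"

definition almost_complex_structure ::
    "('m, 'e::euclidean_space) chart set \<Rightarrow> ('m, 'e) endo_field \<Rightarrow> bool" where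
  "almost_complex_structure A J \<longleftrightarrow>
     (\<forall>c\<in>A. \<forall>x\<in>chart_image c. linear (J c x) \<and> (\<forall>u. J c x (J c x u) = - u)) \<and>
     (\<forall>c\<in>A. \<forall>u. smooth_on (chart_image c) (\<lambda>x. J c x u)) \<and>
     (\<forall>c\<in>A. \<forall>d\<in>A. \<forall>x\<in>overlap c d. \<forall>u.
        frechet_derivative (transition c d) (at x) (J c x u) =
        J d (transition c d x) (frechet_derivative (transition c d) (at x) u))"

text \<open>For metric components \<open>g\<close> on an open subset of a Euclidean space, \<open>christoffel g x u v\<close> is the
  value at \<open>x\<close> of the Levi-Civita derivative along \<open>u\<close> of the constant vector field \<open>v\<close>, determined
  by the Koszul formula.\<close>

definition christoffel ::
    "('e::euclidean_space \<Rightarrow> 'e \<Rightarrow> 'e \<Rightarrow> real) \<Rightarrow> 'e \<Rightarrow> 'e \<Rightarrow> 'e \<Rightarrow> 'e" where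
  "christoffel g x u v = (THE z. \<forall>w. 2 * g x z w =
      frechet_derivative (\<lambda>y. g y v w) (at x) u
    + frechet_derivative (\<lambda>y. g y u w) (at x) v
    - frechet_derivative (\<lambda>y. g y u v) (at x) w)"

text \<open>The curvature tensor R(u,v)w, evaluated on constant vector fields (which commute).\<close>

definition curvature ::
    "('e::euclidean_space \<Rightarrow> 'e \<Rightarrow> 'e \<Rightarrow> real) \<Rightarrow> 'e \<Rightarrow> 'e \<Rightarrow> 'e \<Rightarrow> 'e \<Rightarrow> 'e" where
  "curvature g x u v w =
      frechet_derivative (\<lambda>y. christoffel g y v w) (at x) u
    - frechet_derivative (\<lambda>y. christoffel g y u w) (at x) v
    + christoffel g x u (christoffel g x v w)
    - christoffel g x v (christoffel g x u w)"

text \<open>The covariant derivative of an endomorphism field \<open>j\<close> along \<open>u\<close>, applied to \<open>v\<close>.\<close>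

definition covariant_derivative_endo ::
    "('e::euclidean_space \<Rightarrow> 'e \<Rightarrow> 'e \<Rightarrow> real) \<Rightarrow> ('e \<Rightarrow> 'e \<Rightarrow> 'e) \<Rightarrow> 'e \<Rightarrow> 'e \<Rightarrow> 'e \<Rightarrow> 'e" where
  "covariant_derivative_endo g j x u v =
      frechet_derivative (\<lambda>y. j y v) (at x) u
    + christoffel g x u (j x v) - j x (christoffel g x u v)"

definition kaehler_manifold ::
    "('m::{t2_space, second_countable_topology}, 'e::euclidean_space) chart set \<Rightarrow>
     ('m, 'e) metric_field \<Rightarrow> ('m, 'e) endo_field \<Rightarrow> bool" where
  "kaehler_manifold A G J \<longleftrightarrow>
     smooth_atlas A \<and> riemannian_metric A G \<and> almost_complex_structure A J \<and>
     (\<forall>c\<in>A. \<forall>x\<in>chart_image c. \<forall>u v. G c x (J c x u) (J c x v) = G c x u v) \<and>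
     (\<forall>c\<in>A. \<forall>x\<in>chart_image c. \<forall>u v. covariant_derivative_endo (G c) (J c) x u v = 0)"

definition flat_point ::
    "('m, 'e::euclidean_space) chart set \<Rightarrow> ('m, 'e) metric_field \<Rightarrow> 'm \<Rightarrow> bool" where
  "flat_point A G p \<longleftrightarrow>
     (\<forall>c\<in>A. p \<in> fst c \<longrightarrow> (\<forall>u v w. curvature (G c) (snd c p) u v w = 0))"


section \<open>Immersions into Euclidean space\<close>

definition immersion ::
    "('m, 'e::euclidean_space) chart set \<Rightarrow> ('m \<Rightarrow> 'v::euclidean_space) \<Rightarrow> bool" where
  "immersion A f \<longleftrightarrow>
     smooth_map A f \<and> (\<forall>c\<in>A. \<forall>x\<in>chart_image c. inj (differential c f x))"

definition has_conformal_factor ::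
    "('m, 'e::euclidean_space) chart set \<Rightarrow> ('m, 'e) metric_field \<Rightarrow>
     ('m \<Rightarrow> 'v::euclidean_space) \<Rightarrow> ('m \<Rightarrow> real) \<Rightarrow> bool" where
  "has_conformal_factor A G f l \<longleftrightarrow>
     (\<forall>c\<in>A. \<forall>x\<in>chart_image c. \<forall>u v.
        differential c f x u \<bullet> differential c f x v = (l (chart_inv c x))\<^sup>2 * G c x u v)"

definition conformal_immersion ::
    "('m, 'e::euclidean_space) chart set \<Rightarrow> ('m, 'e) metric_field \<Rightarrow>
     ('m \<Rightarrow> 'v::euclidean_space) \<Rightarrow> bool" where
  "conformal_immersion A G f \<longleftrightarrow> immersion A f \<and>
     (\<exists>l. smooth_map A l \<and> (\<forall>p\<in>carrier A. l p > 0) \<and> has_conformal_factor A G f l)"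

definition isometric_immersion ::
    "('m, 'e::euclidean_space) chart set \<Rightarrow> ('m, 'e) metric_field \<Rightarrow>
     ('m \<Rightarrow> 'v::euclidean_space) \<Rightarrow> bool" where
  "isometric_immersion A G f \<longleftrightarrow> immersion A f \<and> has_conformal_factor A G f (\<lambda>_. 1)"


section \<open>Moebius transformations\<close>

text \<open>Moebius transformations act on the one-point compactification, with \<open>None\<close> as the point at
  infinity; they are the finite compositions of reflections in hyperplanes and inversions in
  spheres (so similarities are included).  Such a map is defined, as a partial transformation of the
  Euclidean space itself, at the points it does not send to \<open>None\<close>.\<close>

definition hyperplane_reflection ::
    "'v::euclidean_space \<Rightarrow> real \<Rightarrow> 'v option \<Rightarrow> 'v option" where
  "hyperplane_reflection a b = map_option (\<lambda>x. x - (2 * (a \<bullet> x - b) / (a \<bullet> a)) *\<^sub>R a)"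

definition sphere_inversion ::
    "'v::euclidean_space \<Rightarrow> real \<Rightarrow> 'v option \<Rightarrow> 'v option" where
  "sphere_inversion a r z = (case z of
       None \<Rightarrow> Some a
     | Some x \<Rightarrow> if x = a then None else Some (a + (r\<^sup>2 / (norm (x - a))\<^sup>2) *\<^sub>R (x - a)))"

inductive moebius_transformation :: "('v::euclidean_space option \<Rightarrow> 'v option) \<Rightarrow> bool" where
  id: "moebius_transformation id"
| reflection: "moebius_transformation t \<Longrightarrow> a \<noteq> 0 \<Longrightarrow>
    moebius_transformation (hyperplane_reflection a b \<circ> t)"
| inversion: "moebius_transformation t \<Longrightarrow> r > 0 \<Longrightarrow>
    moebius_transformation (sphere_inversion a r \<circ> t)"

end

theory Submission
  imports Defs
begin

text \<open>Lift \<open>f\<close> to the light cone of Lorentz space by \<open>F = (f, 1, \<bar>f\<bar>\<^sup>2) / \<lambda>\<close>, which is isometric for the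
  Kaehler metric \<open>g\<close>.  In a normal frame \<open>F, \<xi>, \<zeta>\<close> with \<open>\<xi>\<close> a unit vector and \<open>\<zeta>\<close> null, the second
  fundamental form has components \<open>-g\<close>, \<open>b\<close>, \<open>-s\<close>, and the Gauss equation writes the curvature as
  \<open>b \<and> b / 2 + s \<and> g\<close>.  This tensor is of Kaehler type, which in complex dimension at least 4 forces
  \<open>s + \<mu> b = \<mu>\<^sup>2 / 2 g\<close> for some number \<open>\<mu>\<close>: the null normal vector \<open>w = \<zeta> - \<mu> \<xi> - \<mu>\<^sup>2 / 2 F\<close> is
  orthogonal to the second fundamental form.  Away from flat points \<open>w\<close> is unique, and by the Codazzi
  equation it is constant.  A constant null vector \<open>w\<close> with \<open>\<langle>w, F\<rangle> = 1\<close> says that \<open>\<lambda>\<close> is either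
  constant or a multiple of \<open>\<bar>f - a\<bar>\<^sup>2\<close> for a point \<open>a\<close>; a scaling, respectively the inversion centred
  at \<open>a\<close>, makes \<open>f\<close> isometric.\<close>

section \<open>Calculus of smooth maps\<close>

text \<open>The number \<open>\<mu>\<close> comes from the \<open>J\<close>-average of the form
  \<open>b\<close>. On complex orthogonal pairs the Kaehler condition relates only the averages of
  \<open>b\<close> and \<open>s\<close>. Eigenvectors of the averaged \<open>b\<close> for its
  largest and smallest eigenvalues, if these differ, are compared with two further directions, which
  takes four complex lines. The comparison shows that one of the two eigenvalues equals the common
  eigenvalue \<open>\<mu>\<close> on the complement, so that only one complex line is exceptional.
  The analytic obstacle is that normal frame, \<open>\<mu>\<close> and \<open>w\<close> are obtained
  point by point, without any regularity. Therefore \<open>w\<close> is described without a frame,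
  by its products with \<open>F\<close> and with the first and second derivatives of
  \<open>F\<close>. At a non-flat point these vectors span the ambient space, so \<open>w\<close>
  solves a linear system with differentiable coefficients and unique solution, and is differentiable
  for that reason. Only then can Codazzi be used, in the form of the symmetry of third derivatives
  of \<open>F\<close>. As \<open>w\<close> lies in a fixed vector space, the vectors found in
  different charts can be compared directly, and connectedness makes them one.\<close>

definition dir :: "'a::real_normed_vector \<Rightarrow> ('a \<Rightarrow> 'b::real_normed_vector) \<Rightarrow> 'a \<Rightarrow> 'b" where
  "dir v f x = frechet_derivative f (at x) v"

lemma dir_eq: "(f has_derivative f') (at x) \<Longrightarrow> dir v f x = f' v"
  by (metis dir_def frechet_derivative_at)

lemma has_derivative_dir: "f differentiable (at x) \<Longrightarrow> (f has_derivative (\<lambda>v. dir v f x)) (at x)"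
  using frechet_derivative_works[of f "at x"] by (simp add: dir_def[abs_def])

lemma dir_const: "dir v (\<lambda>x. c) x = 0"
  by (simp add: dir_def)

lemma dir_linear: "f differentiable (at x) \<Longrightarrow> linear (\<lambda>v. dir v f x)"
  using has_derivative_dir has_derivative_linear by blast

text \<open>\<open>frechet_derivative\<close> chooses among all derivatives at a point, and locally
  equal functions have the same ones. Hence the equation is available before differentiability is
  known.\<close>

lemma dir_cong:
  assumes "open S" "x \<in> S" "\<And>y. y \<in> S \<Longrightarrow> f y = g y"
  shows "dir v f x = dir v g x"
proof (cases "f differentiable at x")
  case True
  then show ?thesis
    unfolding dir_def using frechet_derivative_transform_within_open[OF True assms(1,2)] assms(3) by simp
next
  case False
  have "(f has_derivative d) (at x) \<longleftrightarrow> (g has_derivative d) (at x)" for d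
    using has_derivative_transform_within_open[OF _ assms(1,2), of f d UNIV g]
      has_derivative_transform_within_open[OF _ assms(1,2), of g d UNIV f] assms(3) by auto
  then show ?thesis
    by (simp add: dir_def frechet_derivative_def)
qed

lemma differentiable_cong_open:
  assumes "open S" "x \<in> S" "\<And>y. y \<in> S \<Longrightarrow> f y = g y" "f differentiable (at x)"
  shows "g differentiable (at x)"
  using assms has_derivative_transform_within_open[OF _ assms(1,2), of f _ UNIV g]
  unfolding differentiable_def by auto

lemma continuously_differentiable_Suc:
  "continuously_differentiable (Suc k) S f \<longleftrightarrow>
    (\<forall>x\<in>S. f differentiable (at x)) \<and> (\<forall>v. continuously_differentiable k S (dir v f))"
  by (simp add: dir_def[abs_def])

lemma continuously_differentiable_mono:
  "continuously_differentiable (Suc k) S f \<Longrightarrow> continuously_differentiable k S f"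
proof (induction k arbitrary: f)
  case 0
  then show ?case
    by (auto intro!: continuous_at_imp_continuous_on differentiable_imp_continuous_within)
next
  case (Suc k)
  then show ?case
    unfolding continuously_differentiable_Suc[of "Suc k"] continuously_differentiable_Suc[of k] by blast
qed

text \<open>Smoothness becomes a property inherited by directional derivatives, with no order to
  keep track of.\<close>

lemma smooth_on_iff:
  "smooth_on S f \<longleftrightarrow> (\<forall>x\<in>S. f differentiable (at x)) \<and> (\<forall>v. smooth_on S (dir v f))"
proof
  assume f: "smooth_on S f"
  then have "continuously_differentiable (Suc k) S f" for k
    by (simp only: smooth_on_def)
  then show "(\<forall>x\<in>S. f differentiable (at x)) \<and> (\<forall>v. smooth_on S (dir v f))"
    by (simp add: smooth_on_def continuously_differentiable_Suc del: continuously_differentiable.simps)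
next
  assume "(\<forall>x\<in>S. f differentiable (at x)) \<and> (\<forall>v. smooth_on S (dir v f))"
  then have "continuously_differentiable (Suc k) S f" for k
    by (simp add: smooth_on_def continuously_differentiable_Suc del: continuously_differentiable.simps)
  then show "smooth_on S f"
    by (simp add: smooth_on_def continuously_differentiable_mono del: continuously_differentiable.simps)
qed

lemma smooth_on_differentiable: "smooth_on S f \<Longrightarrow> x \<in> S \<Longrightarrow> f differentiable (at x)"
  using smooth_on_iff by blast

lemma smooth_on_dir: "smooth_on S f \<Longrightarrow> smooth_on S (dir v f)"
  using smooth_on_iff by blast

lemma smooth_on_continuous: "smooth_on S f \<Longrightarrow> continuous_on S f"
  unfolding smooth_on_def by (metis continuously_differentiable.simps(1))

lemma continuously_differentiable_cong:
  assumes "open S" "\<And>y. y \<in> S \<Longrightarrow> f y = g y" "continuously_differentiable k S f"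
  shows "continuously_differentiable k S g"
  using assms(2,3)
proof (induction k arbitrary: f g)
  case 0
  then show ?case using continuous_on_cong by fastforce
next
  case (Suc k)
  have "dir v f y = dir v g y" if "y \<in> S" for v y
    using dir_cong[OF assms(1) that] Suc.prems(1) by blast
  then show ?case
    using Suc differentiable_cong_open[OF assms(1)] unfolding continuously_differentiable_Suc by metis
qed

lemma continuously_differentiable_const: "continuously_differentiable k S (\<lambda>x. c)"
proof (induction k arbitrary: c)
  case (Suc k)
  have "dir v (\<lambda>x. c) = (\<lambda>x. 0)" for v :: 'a
    by (rule ext) (auto intro!: dir_eq)
  then show ?case using Suc by (simp only: continuously_differentiable_Suc) simp
qed auto

lemma smooth_on_const: "smooth_on S (\<lambda>x. c)"
  by (simp add: smooth_on_def continuously_differentiable_const)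

lemma dir_add:
  assumes "f differentiable (at x)" "g differentiable (at x)"
  shows "dir v (\<lambda>x. f x + g x) x = dir v f x + dir v g x"
  by (rule dir_eq) (intro has_derivative_add has_derivative_dir assms)

lemma continuously_differentiable_add:
  assumes "open S" "continuously_differentiable k S f" "continuously_differentiable k S g"
  shows "continuously_differentiable k S (\<lambda>x. f x + g x)"
  using assms(2,3)
proof (induction k arbitrary: f g)
  case 0
  then show ?case by (auto intro: continuous_on_add)
next
  case (Suc k)
  have "continuously_differentiable k S (dir v (\<lambda>x. f x + g x))" for v
    by (rule continuously_differentiable_cong[OF assms(1), of "\<lambda>x. dir v f x + dir v g x"])
      (use Suc in \<open>auto simp: continuously_differentiable_Suc dir_add simp del: continuously_differentiable.simps\<close>)
  then show ?case
    using Suc.prems unfolding continuously_differentiable_Suc by auto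
qed

lemma smooth_on_add:
  "open S \<Longrightarrow> smooth_on S f \<Longrightarrow> smooth_on S g \<Longrightarrow> smooth_on S (\<lambda>x. f x + g x)"
  by (simp add: smooth_on_def continuously_differentiable_add)

section \<open>Products, linear images and reciprocals of smooth maps\<close>

context bounded_bilinear
begin

lemma dir_prod:
  assumes "f differentiable (at x)" "g differentiable (at x)"
  shows "dir v (\<lambda>x. prod (f x) (g x)) x = prod (f x) (dir v g x) + prod (dir v f x) (g x)"
  by (rule dir_eq) (intro FDERIV has_derivative_dir assms)

lemma differentiable_prod:
  assumes "f differentiable (at x)" "g differentiable (at x)"
  shows "(\<lambda>x. prod (f x) (g x)) differentiable (at x)"
  using FDERIV assms unfolding differentiable_def by blast

lemma continuously_differentiable_prod:
  assumes "open S" "continuously_differentiable k S f" "continuously_differentiable k S g"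
  shows "continuously_differentiable k S (\<lambda>x. prod (f x) (g x))"
  using assms(2,3)
proof (induction k arbitrary: f g)
  case 0
  then show ?case by (auto intro: continuous_on)
next
  case (Suc k)
  have 1: "continuously_differentiable k S (\<lambda>x. prod (f x) (dir v g x) + prod (dir v f x) (g x))" for v
    using Suc.prems continuously_differentiable_mono[OF Suc.prems(1)] continuously_differentiable_mono[OF Suc.prems(2)]
    by (intro continuously_differentiable_add assms(1) Suc.IH)
      (auto simp: continuously_differentiable_Suc simp del: continuously_differentiable.simps)
  have 2: "prod (f x) (dir v g x) + prod (dir v f x) (g x) = dir v (\<lambda>x. prod (f x) (g x)) x"
    if "x \<in> S" for v x
    using Suc.prems that unfolding continuously_differentiable_Suc by (intro dir_prod[symmetric]) auto
  have "continuously_differentiable k S (dir v (\<lambda>x. prod (f x) (g x)))" for v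
    by (rule continuously_differentiable_cong[OF assms(1) 2 1])
  then show ?case
    using Suc.prems differentiable_prod unfolding continuously_differentiable_Suc by blast
qed

lemma smooth_on_prod:
  "open S \<Longrightarrow> smooth_on S f \<Longrightarrow> smooth_on S g \<Longrightarrow> smooth_on S (\<lambda>x. prod (f x) (g x))"
  by (simp add: smooth_on_def continuously_differentiable_prod)

end

lemmas smooth_on_inner = bounded_bilinear.smooth_on_prod[OF bounded_bilinear_inner]
lemmas smooth_on_scaleR = bounded_bilinear.smooth_on_prod[OF bounded_bilinear_scaleR]
lemmas smooth_on_mult = bounded_bilinear.smooth_on_prod[OF bounded_bilinear_mult]

lemma dir_bounded_linear:
  assumes "bounded_linear h" "f differentiable (at x)"
  shows "dir v (\<lambda>x. h (f x)) x = h (dir v f x)"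
  by (rule dir_eq) (intro bounded_linear.has_derivative[OF assms(1)] has_derivative_dir assms)

lemma smooth_on_bounded_linear:
  assumes "open S" "bounded_linear h" "smooth_on S f"
  shows "smooth_on S (\<lambda>x. h (f x))"
proof -
  have "continuously_differentiable k S f \<Longrightarrow> continuously_differentiable k S (\<lambda>x. h (f x))" for k
  proof (induction k arbitrary: f)
    case 0
    then show ?case
      using bounded_linear.continuous_on[OF assms(2)] by auto
  next
    case (Suc k)
    have d: "\<And>x. x \<in> S \<Longrightarrow> f differentiable (at x)" "\<And>v. continuously_differentiable k S (dir v f)"
      using Suc.prems unfolding continuously_differentiable_Suc by blast+
    have "continuously_differentiable k S (dir v (\<lambda>x. h (f x)))" for v
      by (rule continuously_differentiable_cong[OF assms(1) _ Suc.IH[OF d(2)]])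
        (rule dir_bounded_linear[OF assms(2) d(1), symmetric])
    moreover have "(\<lambda>x. h (f x)) differentiable (at x)" if "x \<in> S" for x
      using Suc.prems that bounded_linear.has_derivative[OF assms(2)]
      unfolding differentiable_def continuously_differentiable_Suc by blast
    ultimately show ?case unfolding continuously_differentiable_Suc by blast
  qed
  then show ?thesis using assms(3) by (simp add: smooth_on_def)
qed

lemma smooth_on_inverse:
  fixes f :: "'a::euclidean_space \<Rightarrow> real"
  assumes "open S" "smooth_on S f" "\<And>x. x \<in> S \<Longrightarrow> f x \<noteq> 0"
  shows "smooth_on S (\<lambda>x. inverse (f x))"
proof -
  have D: "((\<lambda>x. inverse (f x)) has_derivative (\<lambda>v. - (inverse (f x) * dir v f x * inverse (f x)))) (at x)"
    if "x \<in> S" for x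
    by (rule Deriv.has_derivative_inverse)
      (use assms(3)[OF that] has_derivative_dir[OF smooth_on_differentiable[OF assms(2) that]] in auto)
  have "continuously_differentiable k S (\<lambda>x. inverse (f x))" for k
  proof (induction k)
    case 0
    then show ?case
      using smooth_on_continuous[OF assms(2)] assms(3) by (auto intro: continuous_on_inverse)
  next
    case (Suc k)
    have c: "continuously_differentiable k S (dir v f)" for v
      using smooth_on_dir[OF assms(2)] by (simp add: smooth_on_def)
    note mult = bounded_bilinear.continuously_differentiable_prod[OF bounded_bilinear_mult assms(1)]
    have "continuously_differentiable k S (\<lambda>x. (- 1) * (inverse (f x) * dir v f x * inverse (f x)))" for v
      by (intro mult Suc c continuously_differentiable_const)
    then have "continuously_differentiable k S (dir v (\<lambda>x. inverse (f x)))" for v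
      by (rule continuously_differentiable_cong[OF assms(1), rotated, of _ "\<lambda>x. (- 1) * (inverse (f x) * dir v f x * inverse (f x))"])
        (simp add: dir_eq[OF D])
    then show ?case
      using D unfolding continuously_differentiable_Suc differentiable_def by blast
  qed
  then show ?thesis by (simp add: smooth_on_def)
qed

section \<open>Symmetry of second derivatives\<close>

lemma has_real_derivative_along_line:
  fixes f :: "'a::real_normed_vector \<Rightarrow> real"
  assumes "f differentiable (at (a + t *\<^sub>R u))"
  shows "((\<lambda>t. f (a + t *\<^sub>R u)) has_real_derivative dir u f (a + t *\<^sub>R u)) (at t)"
proof -
  have "((\<lambda>t. a + t *\<^sub>R u) has_derivative (\<lambda>h. h *\<^sub>R u)) (at t)"
    by (auto intro!: derivative_eq_intros)
  then have "((\<lambda>t. f (a + t *\<^sub>R u)) has_derivative (\<lambda>h. dir (h *\<^sub>R u) f (a + t *\<^sub>R u))) (at t)"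
    using has_derivative_dir[OF assms] by (rule has_derivative_compose)
  moreover have "dir (h *\<^sub>R u) f (a + t *\<^sub>R u) = dir u f (a + t *\<^sub>R u) * h" for h
    using linear_scale[OF dir_linear[OF assms]] by simp
  ultimately show ?thesis
    by (simp add: has_field_derivative_def)
qed

text \<open>The mean value theorem along \<open>u\<close>, then along \<open>v\<close>. The second
  difference is symmetric in \<open>u\<close> and \<open>v\<close>, so for small \<open>h\<close>
  the two mixed derivatives must agree.\<close>

lemma second_difference_eq:
  fixes f :: "'a::euclidean_space \<Rightarrow> real"
  assumes "open S" "smooth_on S f" "h > 0"
    and S: "\<And>s t. \<lbrakk>0 \<le> s; s \<le> h; 0 \<le> t; t \<le> h\<rbrakk> \<Longrightarrow> x + s *\<^sub>R u + t *\<^sub>R v \<in> S"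
  shows "\<exists>s t. 0 \<le> s \<and> s \<le> h \<and> 0 \<le> t \<and> t \<le> h \<and>
    f (x + h *\<^sub>R u + h *\<^sub>R v) - f (x + h *\<^sub>R u) - f (x + h *\<^sub>R v) + f x =
      h * h * dir v (dir u f) (x + s *\<^sub>R u + t *\<^sub>R v)"
proof -
  have S': "x + t *\<^sub>R v + s *\<^sub>R u \<in> S" if "0 \<le> s" "s \<le> h" "0 \<le> t" "t \<le> h" for s t
    using S[OF that] by (simp add: algebra_simps)
  have S0: "x + s *\<^sub>R u \<in> S" if "0 \<le> s" "s \<le> h" for s
    using S[OF that, of 0] assms(3) by simp
  let ?p = "\<lambda>s. f (x + h *\<^sub>R v + s *\<^sub>R u) - f (x + s *\<^sub>R u)"
  have "\<exists>s. 0 < s \<and> s < h \<and>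
      ?p h - ?p 0 = (h - 0) * (dir u f (x + h *\<^sub>R v + s *\<^sub>R u) - dir u f (x + s *\<^sub>R u))"
    by (rule MVT2[OF assms(3)], rule DERIV_diff; rule has_real_derivative_along_line,
        rule smooth_on_differentiable[OF assms(2)])
      (use S' S0 assms(3) in auto)
  then obtain s where s: "0 < s" "s < h" and
    1: "?p h - ?p 0 = h * (dir u f (x + h *\<^sub>R v + s *\<^sub>R u) - dir u f (x + s *\<^sub>R u))" by auto
  have "\<exists>t. 0 < t \<and> t < h \<and>
      dir u f (x + s *\<^sub>R u + h *\<^sub>R v) - dir u f (x + s *\<^sub>R u + 0 *\<^sub>R v) =
        (h - 0) * dir v (dir u f) (x + s *\<^sub>R u + t *\<^sub>R v)"
    by (rule MVT2[OF assms(3)], rule has_real_derivative_along_line,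
        rule smooth_on_differentiable[OF smooth_on_dir[OF assms(2)]])
      (use S s assms(3) in auto)
  then obtain t where "0 < t" "t < h"
    "dir u f (x + s *\<^sub>R u + h *\<^sub>R v) - dir u f (x + s *\<^sub>R u) = h * dir v (dir u f) (x + s *\<^sub>R u + t *\<^sub>R v)"
    by auto
  then show ?thesis using 1 s
    by (intro exI[of _ s] exI[of _ t]) (simp add: algebra_simps)
qed

lemma dir_commute_real:
  fixes f :: "'a::euclidean_space \<Rightarrow> real"
  assumes "open S" "smooth_on S f" "x \<in> S"
  shows "dir u (dir v f) x = dir v (dir u f) x"
proof (rule ccontr)
  assume ne: "dir u (dir v f) x \<noteq> dir v (dir u f) x"
  define e where "e = \<bar>dir u (dir v f) x - dir v (dir u f) x\<bar> / 2"
  have e: "e > 0" using ne by (simp add: e_def)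
  have cont: "isCont (dir a (dir b f)) x" for a b
    using smooth_on_continuous[OF smooth_on_dir[OF smooth_on_dir[OF assms(2)]]] assms(1,3)
      continuous_on_eq_continuous_at by blast
  have near: "\<exists>d>0. \<forall>y. dist y x < d \<longrightarrow> dist (dir a (dir b f) y) (dir a (dir b f) x) < e" for a b
    using cont[of a b] e unfolding continuous_at_eps_delta by blast
  obtain d1 where d1: "d1 > 0" "\<And>y. dist y x < d1 \<Longrightarrow> dist (dir u (dir v f) y) (dir u (dir v f) x) < e"
    using near by blast
  obtain d2 where d2: "d2 > 0" "\<And>y. dist y x < d2 \<Longrightarrow> dist (dir v (dir u f) y) (dir v (dir u f) x) < e"
    using near by blast
  obtain d3 where d3: "d3 > 0" "ball x d3 \<subseteq> S"
    using assms(1,3) open_contains_ball by blast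
  define d where "d = min d1 (min d2 d3)"
  have d: "d > 0" using d1 d2 d3 by (simp add: d_def)
  \<comment> \<open>Small enough to keep the parallelogram spanned by \<open>h *\<^sub>R u\<close>
    and \<open>h *\<^sub>R v\<close> within distance \<open>d\<close> of \<open>x\<close>; the 1
    keeps the denominator positive.\<close>
  define h where "h = d / (norm u + norm v + 1) / 2"
  have h: "h > 0" using d by (simp add: h_def add_nonneg_pos)
  have close: "norm (s *\<^sub>R u + t *\<^sub>R v) < d" if "0 \<le> s" "s \<le> h" "0 \<le> t" "t \<le> h" for s t
  proof -
    have "norm (s *\<^sub>R u + t *\<^sub>R v) \<le> s * norm u + t * norm v"
      using that by (metis norm_triangle_ineq norm_scaleR abs_of_nonneg)
    also have "\<dots> \<le> h * norm u + h * norm v"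
      by (intro add_mono mult_right_mono that norm_ge_zero)
    also have "\<dots> \<le> h * (norm u + norm v + 1)" using h by (simp add: algebra_simps)
    also have "\<dots> = d / 2"
    proof -
      have "norm u + norm v + 1 \<noteq> 0" by (smt (verit) norm_ge_zero)
      then show ?thesis unfolding h_def by (simp add: divide_simps)
    qed
    also have "\<dots> < d" using d by simp
    finally show ?thesis .
  qed
  have dist: "dist (x + s *\<^sub>R u + t *\<^sub>R v) x < d" "dist (x + s *\<^sub>R v + t *\<^sub>R u) x < d"
    if "0 \<le> s" "s \<le> h" "0 \<le> t" "t \<le> h" for s t
    using close[of s t] close[of t s] that by (simp_all add: dist_norm algebra_simps)
  have inS: "y \<in> S" if "dist y x < d" for y
    using that d3(2) by (auto simp: d_def dist_commute)
  obtain s t where 1: "0 \<le> s" "s \<le> h" "0 \<le> t" "t \<le> h"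
    "f (x + h *\<^sub>R u + h *\<^sub>R v) - f (x + h *\<^sub>R u) - f (x + h *\<^sub>R v) + f x =
      h * h * dir v (dir u f) (x + s *\<^sub>R u + t *\<^sub>R v)"
    using second_difference_eq[OF assms(1,2) h, of x u v] dist inS by blast
  obtain s' t' where 2: "0 \<le> s'" "s' \<le> h" "0 \<le> t'" "t' \<le> h"
    "f (x + h *\<^sub>R v + h *\<^sub>R u) - f (x + h *\<^sub>R v) - f (x + h *\<^sub>R u) + f x =
      h * h * dir u (dir v f) (x + s' *\<^sub>R v + t' *\<^sub>R u)"
    using second_difference_eq[OF assms(1,2) h, of x v u] dist inS by blast
  have "h * h * dir v (dir u f) (x + s *\<^sub>R u + t *\<^sub>R v) = h * h * dir u (dir v f) (x + s' *\<^sub>R v + t' *\<^sub>R u)"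
    using 1(5) 2(5) by (simp add: algebra_simps)
  then have eq: "dir v (dir u f) (x + s *\<^sub>R u + t *\<^sub>R v) = dir u (dir v f) (x + s' *\<^sub>R v + t' *\<^sub>R u)"
    using h by simp
  have "dist (dir v (dir u f) (x + s *\<^sub>R u + t *\<^sub>R v)) (dir v (dir u f) x) < e"
    "dist (dir u (dir v f) (x + s' *\<^sub>R v + t' *\<^sub>R u)) (dir u (dir v f) x) < e"
    using d1(2) d2(2) dist(1)[OF 1(1-4)] dist(2)[OF 2(1-4)] by (auto simp: d_def)
  then show False
    unfolding eq dist_real_def e_def by (simp add: abs_real_def split: if_splits)
qed

lemma dir_commute:
  fixes f :: "'a::euclidean_space \<Rightarrow> 'b::real_inner"
  assumes "open S" "smooth_on S f" "x \<in> S"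
  shows "dir u (dir v f) x = dir v (dir u f) x"
proof -
  have *: "dir b (dir a (\<lambda>x. f x \<bullet> c)) x = dir b (dir a f) x \<bullet> c" for a b c
  proof -
    have "dir b (dir a (\<lambda>x. f x \<bullet> c)) x = dir b (\<lambda>x. dir a f x \<bullet> c) x"
      by (rule dir_cong[OF assms(1,3)])
        (rule dir_bounded_linear[OF bounded_linear_inner_left smooth_on_differentiable[OF assms(2)]])
    also have "\<dots> = dir b (dir a f) x \<bullet> c"
      by (rule dir_bounded_linear[OF bounded_linear_inner_left
            smooth_on_differentiable[OF smooth_on_dir[OF assms(2)] assms(3)]])
    finally show ?thesis .
  qed
  have "dir u (dir v f) x \<bullet> c = dir v (dir u f) x \<bullet> c" for c
    using dir_commute_real[OF assms(1) smooth_on_bounded_linear[OF assms(1) bounded_linear_inner_left assms(2)] assms(3)]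
    by (simp add: *)
  then show ?thesis
    using vector_eq_rdot by blast
qed

section \<open>Positive definite forms\<close>

lemma linear_functional_eq_inner:
  fixes h :: "'e::euclidean_space \<Rightarrow> real"
  assumes "linear h"
  obtains r where "\<And>u. h u = r \<bullet> u"
proof
  show "h u = (\<Sum>i\<in>Basis. h i *\<^sub>R i) \<bullet> u" for u
  proof -
    have "h u = h (\<Sum>i\<in>Basis. (u \<bullet> i) *\<^sub>R i)" by (simp add: euclidean_representation)
    also have "\<dots> = (\<Sum>i\<in>Basis. (u \<bullet> i) * h i)"
      by (simp add: linear_sum[OF assms] linear_scale[OF assms])
    also have "\<dots> = (\<Sum>i\<in>Basis. h i *\<^sub>R i) \<bullet> u"
      by (simp add: inner_sum_left) (simp add: inner_commute mult.commute)
    finally show ?thesis .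
  qed
qed

locale positive_form =
  fixes g :: "'e::euclidean_space \<Rightarrow> 'e \<Rightarrow> real"
  assumes g_bilinear: "bilinear g"
    and g_sym: "g x y = g y x"
    and g_pos: "x \<noteq> 0 \<Longrightarrow> g x x > 0"
begin

lemma g_unit_scale:
  assumes "u \<noteq> 0"
  shows "g ((1 / sqrt (g u u)) *\<^sub>R u) ((1 / sqrt (g u u)) *\<^sub>R u) = 1"
  using g_pos[OF assms] g_bilinear by (simp add: bilinear_lmul bilinear_rmul)

lemma eq_zero_if_orthogonal: "(\<And>w. g z w = 0) \<Longrightarrow> z = 0"
  using g_pos[of z] by force

lemma unit_orthogonal_exists:
  assumes "finite S" "card S < DIM('e)"
  obtains u where "g u u = 1" "\<And>a. a \<in> S \<Longrightarrow> g a u = 0"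
proof -
  have lin: "linear (g a)" for a using g_bilinear by (simp add: bilinear_def)
  have "\<exists>r. \<forall>u. g a u = r \<bullet> u" for a
    using linear_functional_eq_inner[OF lin, of a] by metis
  then have "\<exists>r. \<forall>a u. g a u = r a \<bullet> u"
    by (intro choice allI)
  then obtain r where r: "\<And>a u. g a u = r a \<bullet> u" by blast
  have "dim (r ` S) < DIM('e)"
    using dim_le_card'[of "r ` S"] card_image_le[OF assms(1), of r] assms by simp
  then obtain u where u: "u \<noteq> 0" "\<And>y. y \<in> span (r ` S) \<Longrightarrow> orthogonal u y"
    using orthogonal_to_subspace_exists by blast
  have "g a u = 0" if "a \<in> S" for a
    using u(2)[of "r a"] that by (simp add: r orthogonal_def inner_commute span_base)
  then show ?thesis
    using that[OF g_unit_scale[OF u(1)]] g_bilinear by (simp add: bilinear_rmul)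
qed

text \<open>The Rayleigh quotient \<open>h x x / g x x\<close> attains its maximum on the compact
  unit sphere, and a maximum point is an eigenvector.\<close>

lemma maximal_eigenvector:
  assumes h: "bilinear h" and sym: "\<And>x y. h x y = h y x"
  obtains e m where "g e e = 1" "\<And>v. h e v = m * g e v" "\<And>v. h v v \<le> m * g v v"
proof -
  let ?S = "sphere (0::'e) 1"
  have cont: "continuous_on ?S (\<lambda>x. h x x / g x x)"
  proof (intro continuous_on_divide)
    show "continuous_on ?S (\<lambda>x. h x x)" "continuous_on ?S (\<lambda>x. g x x)"
      using h g_bilinear bounded_bilinear.continuous_on[OF _ continuous_on_id continuous_on_id]
      by (auto simp: bilinear_conv_bounded_bilinear)
    show "\<forall>x\<in>?S. g x x \<noteq> 0"
      using g_pos by (metis less_irrefl mem_sphere_0 norm_zero zero_neq_one)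
  qed
  obtain i :: 'e where "i \<in> Basis" using nonempty_Basis by blast
  then have "?S \<noteq> {}" by (force intro: norm_Basis)
  then obtain e0 where e0: "norm e0 = 1" "\<And>x. norm x = 1 \<Longrightarrow> h x x / g x x \<le> h e0 e0 / g e0 e0"
    using continuous_attains_sup[OF compact_sphere _ cont] by auto
  define m where "m = h e0 e0 / g e0 e0"
  have "e0 \<noteq> 0" using e0(1) by auto
  note ge0 = g_pos[OF this]
  have le: "h v v \<le> m * g v v" for v
  proof (cases "v = 0")
    case True
    then show ?thesis using h g_bilinear by (simp add: bilinear_lzero)
  next
    case False
    let ?v = "(1 / norm v) *\<^sub>R v"
    have "h ?v ?v / g ?v ?v = h v v / g v v"
      using False by (simp add: bilinear_lmul[OF h] bilinear_rmul[OF h] bilinear_lmul[OF g_bilinear] bilinear_rmul[OF g_bilinear])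
    moreover have "h ?v ?v / g ?v ?v \<le> m"
      unfolding m_def by (rule e0(2)) (use False in simp)
    ultimately show ?thesis using g_pos[OF False] by (simp add: pos_divide_le_eq)
  qed
  \<comment> \<open>\<open>m * g - h\<close> is positive semidefinite and vanishes at
    \<open>e0\<close>; if \<open>c\<close> were nonzero, moving from \<open>e0\<close> by
    \<open>t *\<^sub>R v\<close> would make it negative. The optimal \<open>t\<close> has
    denominator \<open>d\<close>; taking \<open>d + 1\<close> covers \<open>d = 0\<close> as
    well.\<close>
  have ker: "h e0 v = m * g e0 v" for v
  proof -
    define c where "c = m * g e0 v - h e0 v"
    define d where "d = m * g v v - h v v"
    have d: "d \<ge> 0" using le[of v] by (simp add: d_def)
    define t where "t = - c / (d + 1)"
    have z: "m * g e0 e0 - h e0 e0 = 0" using ge0 by (simp add: m_def)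
    have "0 \<le> m * g (e0 + t *\<^sub>R v) (e0 + t *\<^sub>R v) - h (e0 + t *\<^sub>R v) (e0 + t *\<^sub>R v)"
      using le by simp
    also have "\<dots> = (m * g e0 e0 - h e0 e0) + 2 * t * c + t * t * d"
      unfolding c_def d_def
      by (simp add: bilinear_ladd[OF h] bilinear_radd[OF h] bilinear_lmul[OF h] bilinear_rmul[OF h]
          bilinear_ladd[OF g_bilinear] bilinear_radd[OF g_bilinear] bilinear_lmul[OF g_bilinear] bilinear_rmul[OF g_bilinear]
          sym[of v e0] g_sym[of v e0] algebra_simps)
    also have "\<dots> = - (c * c) * ((d + 2) / ((d + 1) * (d + 1)))"
      using d z unfolding t_def by (simp add: divide_simps) (simp add: algebra_simps)
    finally have "c * c * ((d + 2) / ((d + 1) * (d + 1))) \<le> 0" by simp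
    moreover have "(d + 2) / ((d + 1) * (d + 1)) > 0" using d by simp
    ultimately have "c * c \<le> 0" by (metis mult_le_cancel_right_pos mult_zero_left)
    then have "c = 0" by (metis mult_eq_0_iff order_antisym zero_le_square)
    then show ?thesis by (simp add: c_def)
  qed
  let ?e = "(1 / sqrt (g e0 e0)) *\<^sub>R e0"
  show ?thesis
    by (rule that[OF g_unit_scale[OF \<open>e0 \<noteq> 0\<close>], of m])
      (use ker le in \<open>simp_all add: bilinear_lmul[OF h] bilinear_lmul[OF g_bilinear]\<close>)
qed

end

section \<open>Curvature tensors of Kaehler type in codimension one\<close>

text \<open>The curvature of a light cone immersion: \<open>b\<close> is the second fundamental form in a unit
  direction, \<open>s\<close> the one in a null direction paired with the position vector.\<close>

definition gauss_tensor ::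
    "('e \<Rightarrow> 'e \<Rightarrow> real) \<Rightarrow> ('e \<Rightarrow> 'e \<Rightarrow> real) \<Rightarrow> ('e \<Rightarrow> 'e \<Rightarrow> real) \<Rightarrow> 'e \<Rightarrow> 'e \<Rightarrow> 'e \<Rightarrow> 'e \<Rightarrow> real" where
  "gauss_tensor g b s x y z w =
     b x w * b y z - b x z * b y w + s x w * g y z + g x w * s y z - s x z * g y w - g x z * s y w"

locale hermitian_form = positive_form g for g :: "'e::euclidean_space \<Rightarrow> 'e \<Rightarrow> real" +
  fixes J :: "'e \<Rightarrow> 'e"
  assumes J_linear: "linear J"
    and J_J: "J (J x) = - x"
    and g_J: "g (J x) (J y) = g x y"
begin

lemma g_J_swap: "g (J x) y = - g x (J y)"
  using g_J[of x "J y"] g_bilinear by (simp add: J_J bilinear_rneg)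

lemma g_J_self: "g x (J x) = 0" "g (J x) x = 0"
  using g_J_swap[of x x] g_sym[of x "J x"] by simp_all

text \<open>The average over \<open>J\<close>, that is, the part of type (1,1). For a symmetric form
  its eigenspaces with respect to \<open>g\<close> are complex.\<close>

definition hermitian_part :: "('e \<Rightarrow> 'e \<Rightarrow> real) \<Rightarrow> 'e \<Rightarrow> 'e \<Rightarrow> real" where
  "hermitian_part h x y = (h x y + h (J x) (J y)) / 2"

lemma bilinear_hermitian_part:
  assumes "bilinear h"
  shows "bilinear (hermitian_part h)"
  unfolding bilinear_def linear_iff hermitian_part_def using assms
  by (auto simp: bilinear_ladd bilinear_radd bilinear_lmul bilinear_rmul
      linear_add[OF J_linear] linear_scale[OF J_linear] field_simps)

lemma hermitian_part_swap:
  assumes "bilinear h"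
  shows "hermitian_part h (J x) y = - hermitian_part h x (J y)"
  using assms by (simp add: hermitian_part_def J_J bilinear_rneg bilinear_lneg field_simps)

end

locale kaehler_gauss = hermitian_form g J for g :: "'e::euclidean_space \<Rightarrow> 'e \<Rightarrow> real" and J +
  fixes b s :: "'e \<Rightarrow> 'e \<Rightarrow> real"
  assumes dim: "DIM('e) \<ge> 8"
    and b_bilinear: "bilinear b" and b_sym: "b x y = b y x"
    and s_bilinear: "bilinear s" and s_sym: "s x y = s y x"
    and kaehler: "gauss_tensor g b s x y (J z) (J w) = gauss_tensor g b s x y z w"
begin

abbreviation P where "P \<equiv> hermitian_part b"
abbreviation S where "S \<equiv> hermitian_part s"

lemmas bilinear_simps =
  bilinear_ladd[OF g_bilinear] bilinear_radd[OF g_bilinear] bilinear_lmul[OF g_bilinear]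
  bilinear_rmul[OF g_bilinear] bilinear_lneg[OF g_bilinear] bilinear_rneg[OF g_bilinear]
  bilinear_lsub[OF g_bilinear] bilinear_rsub[OF g_bilinear]

text \<open>Three complex lines fill at most six of at least eight real dimensions. This count is
  where the bound on the dimension enters.\<close>

lemma unit_complex_orthogonal_exists:
  obtains u where "g u u = 1" "g x u = 0" "g (J x) u = 0" "g y u = 0" "g (J y) u = 0"
    "g z u = 0" "g (J z) u = 0"
proof -
  have "card {x, J x, y, J y, z, J z} \<le> 6"
    by (rule card_insert_le_m1, simp)+ simp
  then have "card {x, J x, y, J y, z, J z} < DIM('e)" using dim by simp
  then obtain u where "g u u = 1" "\<And>a. a \<in> {x, J x, y, J y, z, J z} \<Longrightarrow> g a u = 0"
    using unit_orthogonal_exists[of "{x, J x, y, J y, z, J z}"] by blast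
  then show ?thesis using that by simp
qed

lemma P_bilinear: "bilinear P"
  by (simp add: bilinear_hermitian_part b_bilinear)

lemma P_sym: "P x y = P y x"
  by (simp add: hermitian_part_def b_sym[of x] b_sym[of "J x"])

text \<open>The component of the Kaehler condition on \<open>x\<^sup>1\<^sup>,\<^sup>0 \<and> u\<^sup>1\<^sup>,\<^sup>0\<close>, for a complex orthogonal pair.\<close>

lemma hermitian_gauss:
  assumes "g x u = 0" "g (J x) u = 0"
  shows "P x x * P u u - (P x u)\<^sup>2 - (P (J x) u)\<^sup>2 + S x x * g u u + g x x * S u u = 0"
proof -
  have z: "g x (J u) = 0" "g (J x) (J u) = 0" "g u x = 0" "g u (J x) = 0" "g (J u) x = 0" "g (J u) (J x) = 0"
    using assms g_J_swap[of x u] g_J[of x u] g_sym by (metis neg_equal_0_iff_equal)+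
  have sy: "b u x = b x u" "b u (J x) = b (J x) u" "b (J u) x = b x (J u)" "b (J u) (J x) = b (J x) (J u)"
    "b (J x) x = b x (J x)" "b (J u) u = b u (J u)"
    by (rule b_sym)+
  note sm = gauss_tensor_def J_J assms z sy g_J g_J_self bilinear_lneg[OF b_bilinear] bilinear_rneg[OF b_bilinear]
    bilinear_lneg[OF s_bilinear] bilinear_rneg[OF s_bilinear] bilinear_lneg[OF g_bilinear] bilinear_rneg[OF g_bilinear]
  \<comment> \<open>Adding the identities for the pairs \<open>(x, u)\<close>,
    \<open>(x, J u)\<close>, \<open>(J x, u)\<close>, \<open>(J x, J u)\<close> cancels the products
    of \<open>b x (J x)\<close> and \<open>b u (J u)\<close> and assembles all other terms into
    Hermitian parts.\<close>
  note k = kaehler[of x u u x, unfolded sm] kaehler[of x "J u" "J u" x, unfolded sm]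
    kaehler[of "J x" u u "J x", unfolded sm] kaehler[of "J x" "J u" "J u" "J x", unfolded sm]
  show ?thesis
    using k by (simp add: hermitian_part_def sm power2_eq_square field_simps)
qed

text \<open>Largest and smallest eigenvectors \<open>e\<close>, \<open>e'\<close> of the Hermitian part are compared with vectors
  in their common complement; there are two orthogonal ones because the complex dimension is at least 4.\<close>

lemma hermitian_part_rank_one:
  obtains \<mu> \<nu> e where "\<And>v. P v v = \<mu> * g v v + \<nu> * ((g e v)\<^sup>2 + (g (J e) v)\<^sup>2)"
proof -
  obtain e m1 where e: "g e e = 1" "\<And>v. P e v = m1 * g e v" "\<And>v. P v v \<le> m1 * g v v"
    using maximal_eigenvector[OF P_bilinear P_sym] by metis
  \<comment> \<open>The smallest eigenvalue of \<open>P\<close> is minus the largest one of its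
    negative.\<close>
  have nb: "bilinear (\<lambda>x y. - P x y)"
    using P_bilinear unfolding bilinear_def linear_iff by auto
  have ns: "- P x y = - P y x" for x y using P_sym by simp
  obtain e' m where e'0: "g e' e' = 1" "\<And>v. - P e' v = m * g e' v" "\<And>v. - P v v \<le> m * g v v"
    using maximal_eigenvector[OF nb ns] by metis
  define m2 where "m2 = - m"
  have e': "g e' e' = 1" "P e' v = m2 * g e' v" "P v v \<ge> m2 * g v v" for v
    using e'0(1) e'0(2)[of v] e'0(3)[of v] by (simp_all add: m2_def)
  show thesis
  proof (cases "m1 = m2")
    case True
    then have "P v v = m1 * g v v + 0 * ((g e v)\<^sup>2 + (g (J e) v)\<^sup>2)" for v
      using e(3)[of v] e'(3)[of v] by simp
    then show thesis by (rule that)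
  next
    case False
    have Je: "P (J e) v = m1 * g (J e) v" for v
      using hermitian_part_swap[OF b_bilinear, of e v] e(2)[of "J v"] g_J_swap[of e v] by simp
    have Je': "P (J e') v = m2 * g (J e') v" for v
      using hermitian_part_swap[OF b_bilinear, of e' v] e'(2)[of "J v"] g_J_swap[of e' v] by simp
    have "m1 * g e e' = m2 * g e e'" using e(2)[of e'] e'(2)[of e] P_sym[of e e'] g_sym[of e e'] by metis
    then have o1: "g e e' = 0" "g e' e = 0" using False g_sym[of e e'] by auto
    have "m1 * g (J e) e' = m2 * g (J e) e'"
      using Je[of e'] e'(2)[of "J e"] P_sym[of "J e" e'] g_sym[of "J e" e'] by metis
    then have o2: "g (J e) e' = 0" "g e' (J e) = 0" using False g_sym[of "J e" e'] by auto
    have o3: "g e (J e') = 0" "g (J e') e = 0"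
      using o2 g_J_swap[of e e'] g_sym[of e "J e'"] by auto
    define W where "W v \<longleftrightarrow> g e v = 0 \<and> g (J e) v = 0 \<and> g e' v = 0 \<and> g (J e') v = 0" for v
    \<comment> \<open>For \<open>z\<close> in \<open>W\<close> the relations of the pairs
      \<open>(e, z)\<close> and \<open>(e', z)\<close> are two linear equations for
      \<open>P z z\<close> and \<open>S z z\<close>. Since \<open>m1 \<noteq> m2\<close> they have
      one solution: \<open>\<mu>\<close> and \<open>\<rho>\<close>, times
      \<open>g z z\<close>.\<close>
    define \<mu> where "\<mu> = (S e' e' - S e e) / (m1 - m2)"
    define \<rho> where "\<rho> = - (m1 * \<mu> + S e e)"
    have \<mu>': "(m1 - m2) * \<mu> = S e' e' - S e e"
      using False unfolding \<mu>_def by simp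
    then have \<mu>: "m1 * \<mu> + S e e = m2 * \<mu> + S e' e'"
      by (simp add: algebra_simps)
    have PW: "P z z = \<mu> * g z z" and SW: "S z z = \<rho> * g z z" if "W z" for z
    proof -
      have 1: "m1 * P z z + S e e * g z z + S z z = 0"
        using hermitian_gauss[of e z] that e Je by (simp add: W_def)
      have 2: "m2 * P z z + S e' e' * g z z + S z z = 0"
        using hermitian_gauss[of e' z] that e' Je' by (simp add: W_def)
      have "(m1 - m2) * P z z = (S e' e' - S e e) * g z z"
        using 1 2 by (simp add: algebra_simps)
      then have "(m1 - m2) * P z z = (m1 - m2) * (\<mu> * g z z)"
        by (simp flip: \<mu>')
      then show 3: "P z z = \<mu> * g z z" using False by simp
      show "S z z = \<rho> * g z z" using 1 unfolding 3 \<rho>_def by (simp add: algebra_simps)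
    qed
    have WJ: "W (J z)" if "W z" for z
      using that g_J g_J_swap unfolding W_def by (metis neg_equal_0_iff_equal)
    have Wadd: "W (y + z)" if "W y" "W z" for y z
      using that unfolding W_def by (simp add: bilinear_simps)
    have Porth: "P z w = 0" if "W z" "W w" "g z w = 0" for z w
      using PW[OF that(1)] PW[OF that(2)] PW[OF Wadd[OF that(1,2)]] that(3) g_sym[of w z] P_sym[of w z]
      by (simp add: bilinear_simps bilinear_ladd[OF P_bilinear] bilinear_radd[OF P_bilinear] algebra_simps)
    \<comment> \<open>The pairs \<open>(z, w)\<close> and \<open>(e, e')\<close> supply two more
      relations. Eliminating \<open>S\<close> from them leaves
      \<open>(m1 - \<mu>) * (m2 - \<mu>) = 0\<close>, so one extreme eigenvalue is that of
      \<open>W\<close>.\<close>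
    obtain z where z: "g z z = 1" "W z"
      using unit_complex_orthogonal_exists[of e e' e'] W_def by metis
    obtain w where w: "g w w = 1" "W w" "g z w = 0" "g (J z) w = 0"
      using unit_complex_orthogonal_exists[of e e' z] W_def by metis
    have "\<mu> * \<mu> + 2 * \<rho> = 0"
      using hermitian_gauss[OF w(3,4)] Porth[OF z(2) w(2,3)] Porth[OF WJ[OF z(2)] w(2,4)]
        PW[OF z(2)] PW[OF w(2)] SW[OF z(2)] SW[OF w(2)] z w by simp
    moreover have "m1 * m2 + S e e + S e' e' = 0"
      using hermitian_gauss[OF o1(1) o2(1)] e e' Je o1 o2 by simp
    ultimately have "(m1 - \<mu>) * (m2 - \<mu>) = 0"
      using \<mu> unfolding \<rho>_def by (simp add: algebra_simps)
    then have m12: "m1 = \<mu> \<or> m2 = \<mu>" by simp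
    \<comment> \<open>Split \<open>v\<close> into its components along the two complex lines and a
      remainder in \<open>W\<close>, where \<open>P - \<mu> g\<close> vanishes.\<close>
    have Pvv: "P v v - \<mu> * g v v = (m1 - \<mu>) * ((g e v)\<^sup>2 + (g (J e) v)\<^sup>2)
        + (m2 - \<mu>) * ((g e' v)\<^sup>2 + (g (J e') v)\<^sup>2)" for v
    proof -
      define k where "k x y = P x y - \<mu> * g x y" for x y
      define r where "r = v - g e v *\<^sub>R e - g (J e) v *\<^sub>R J e - g e' v *\<^sub>R e' - g (J e') v *\<^sub>R J e'"
      have kb: "bilinear k"
        using P_bilinear g_bilinear unfolding k_def bilinear_def linear_iff by (auto simp: algebra_simps)
      have ksym: "k x y = k y x" for x y by (simp add: k_def P_sym[of x] g_sym[of x])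
      have "W r"
        unfolding W_def r_def by (simp add: bilinear_simps e(1) e'(1) o1 o2 o3 g_J g_J_self)
      then have krr: "k r r = 0" and gr: "g e r = 0" "g (J e) r = 0" "g e' r = 0" "g (J e') r = 0"
        using PW by (auto simp: k_def W_def)
      have k1: "k e y = (m1 - \<mu>) * g e y" "k (J e) y = (m1 - \<mu>) * g (J e) y"
        "k e' y = (m2 - \<mu>) * g e' y" "k (J e') y = (m2 - \<mu>) * g (J e') y" for y
        by (simp_all add: k_def e e' Je Je' algebra_simps)
      have v: "v = r + g e v *\<^sub>R e + g (J e) v *\<^sub>R J e + g e' v *\<^sub>R e' + g (J e') v *\<^sub>R J e'"
        by (simp add: r_def)
      have kv: "k v y = k r y + g e v * k e y + g (J e) v * k (J e) y + g e' v * k e' y + g (J e') v * k (J e') y" for y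
        by (subst v) (simp add: bilinear_ladd[OF kb] bilinear_lmul[OF kb])
      have "k r v = 0" using kv[of r] krr gr k1 ksym[of r v] by simp
      then have "k v v = (m1 - \<mu>) * ((g e v)\<^sup>2 + (g (J e) v)\<^sup>2) + (m2 - \<mu>) * ((g e' v)\<^sup>2 + (g (J e') v)\<^sup>2)"
        using kv[of v] k1 by (simp add: power2_eq_square algebra_simps)
      then show ?thesis by (simp add: k_def)
    qed
    from m12 show thesis
    proof
      assume "m1 = \<mu>"
      then have "P v v = \<mu> * g v v + (m2 - \<mu>) * ((g e' v)\<^sup>2 + (g (J e') v)\<^sup>2)" for v
        using Pvv[of v] by simp
      then show thesis by (rule that)
    next
      assume "m2 = \<mu>"
      then have "P v v = \<mu> * g v v + (m1 - \<mu>) * ((g e v)\<^sup>2 + (g (J e) v)\<^sup>2)" for v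
        using Pvv[of v] by simp
      then show thesis by (rule that)
    qed
  qed
qed

text \<open>Independence of the null frame: passing from \<open>\<xi>\<close>,
  \<open>\<zeta>\<close> to \<open>\<xi> + \<mu> F\<close> and
  \<open>\<zeta> - \<mu> \<xi> - \<mu>\<^sup>2 / 2 F\<close> turns \<open>b\<close> into
  \<open>b0\<close> and \<open>s\<close> into \<open>c\<close>.\<close>

lemma gauss_tensor_shift:
  assumes "\<And>x y. c x y = s x y + \<mu> * b x y - \<mu>\<^sup>2 / 2 * g x y" "\<And>x y. b0 x y = b x y - \<mu> * g x y"
  shows "gauss_tensor g b s = gauss_tensor g b0 c"
  by (intro ext) (simp add: gauss_tensor_def assms power2_eq_square field_simps)

text \<open>In the frame shifted by the \<open>\<mu>\<close> of
  \<open>hermitian_part_rank_one\<close>, the Hermitian part of \<open>b0\<close> lives on the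
  complex line of \<open>e\<close>. Vectors orthogonal to that line see only \<open>c\<close>, and
  there are enough of them to force \<open>c = 0\<close>.\<close>

theorem isotropic_direction:
  obtains \<mu> where "\<And>x y. s x y + \<mu> * b x y = \<mu>\<^sup>2 / 2 * g x y"
proof -
  obtain \<mu> \<nu> e where P: "\<And>v. P v v = \<mu> * g v v + \<nu> * ((g e v)\<^sup>2 + (g (J e) v)\<^sup>2)"
    using hermitian_part_rank_one by blast
  define c where "c x y = s x y + \<mu> * b x y - \<mu>\<^sup>2 / 2 * g x y" for x y
  define b0 where "b0 x y = b x y - \<mu> * g x y" for x y
  have cb: "bilinear c" and b0b: "bilinear b0"
    using s_bilinear b_bilinear g_bilinear unfolding c_def b0_def bilinear_def linear_iff
    by (auto simp: algebra_simps)
  have cs: "c x y = c y x" and b0s: "b0 x y = b0 y x" for x y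
    by (simp_all add: c_def b0_def s_sym[of x] b_sym[of x] g_sym[of x])
  have T: "gauss_tensor g b s = gauss_tensor g b0 c"
    by (rule gauss_tensor_shift[where \<mu> = \<mu>]) (simp_all add: c_def b0_def)
  interpret shifted: kaehler_gauss g J b0 c
    by unfold_locales (use dim cb b0b kaehler cs b0s in \<open>auto simp: T\<close>)
  have P0: "hermitian_part b0 v v = \<nu> * ((g e v)\<^sup>2 + (g (J e) v)\<^sup>2)" for v
    using P[of v] by (simp add: hermitian_part_def b0_def g_J field_simps)
  have P0z: "hermitian_part b0 v y = 0" if "g e v = 0" "g (J e) v = 0" for v y
  proof -
    have "hermitian_part b0 (v + y) (v + y) = hermitian_part b0 y y"
      unfolding P0 using that by (simp add: bilinear_radd[OF g_bilinear])
    moreover have "hermitian_part b0 v v = 0" unfolding P0 using that by simp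
    ultimately show ?thesis
      using shifted.P_sym[of v y] by (simp add: bilinear_ladd[OF shifted.P_bilinear] bilinear_radd[OF shifted.P_bilinear])
  qed
  have pair: "hermitian_part c x x * g u u + g x x * hermitian_part c u u = 0"
    if "g x u = 0" "g (J x) u = 0" "g e u = 0" "g (J e) u = 0" for x u
  proof -
    have "hermitian_part b0 x u = 0" "hermitian_part b0 (J x) u = 0" "hermitian_part b0 u u = 0"
      using P0z[OF that(3,4)] shifted.P_sym by metis+
    then show ?thesis using shifted.hermitian_gauss[OF that(1,2)] by simp
  qed
  \<comment> \<open>The relation between \<open>u\<close> and \<open>v\<close> makes their values of
    the Hermitian part of \<open>c\<close> opposite, so adding the relations with \<open>x\<close>
    leaves twice the value at \<open>x\<close>.\<close>
  have C0: "hermitian_part c x x = 0" for x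
  proof -
    obtain u where u: "g u u = 1" "g x u = 0" "g (J x) u = 0" "g e u = 0" "g (J e) u = 0"
      using unit_complex_orthogonal_exists[of x e e] by metis
    obtain v where v: "g v v = 1" "g x v = 0" "g (J x) v = 0" "g e v = 0" "g (J e) v = 0" "g u v = 0" "g (J u) v = 0"
      using unit_complex_orthogonal_exists[of x e u] by metis
    have *: "hermitian_part c x x + g x x * hermitian_part c u u = 0"
      "hermitian_part c x x + g x x * hermitian_part c v v = 0"
      "hermitian_part c u u + hermitian_part c v v = 0"
      using pair[of x u] pair[of x v] pair[of u v] u v by simp_all
    have "hermitian_part c v v = - hermitian_part c u u" using *(3) by linarith
    then show ?thesis using *(1,2) by simp
  qed
  \<comment> \<open>As \<open>u\<close> is in the kernel of the Hermitian part,
    \<open>b0 (J u) y = b0 u (J y)\<close>. Adding the Kaehler identities for \<open>(x, u)\<close>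
    and \<open>(x, J u)\<close> then cancels every product of values of \<open>b0\<close> and both
    values of \<open>c\<close> on the line of \<open>u\<close>, leaving
    \<open>2 * c x x = 0\<close>.\<close>
  have c0: "c x x = 0" for x
  proof -
    obtain u where u: "g u u = 1" "g x u = 0" "g (J x) u = 0" "g e u = 0" "g (J e) u = 0"
      using unit_complex_orthogonal_exists[of x e e] by metis
    have z: "g x (J u) = 0" "g (J x) (J u) = 0" "g u x = 0" "g u (J x) = 0" "g (J u) x = 0" "g (J u) (J x) = 0"
      using u g_J_swap[of x u] g_J[of x u] g_sym by (metis neg_equal_0_iff_equal)+
    have cu: "c (J u) (J u) = - c u u" using C0[of u] by (simp add: hermitian_part_def)
    have bu: "b0 (J u) (J y) = - b0 u y" for y
      using P0z[OF u(4,5), of y] by (simp add: hermitian_part_def)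
    have buJ: "b0 (J u) y = b0 u (J y)" for y
      using bu[of "J y"] by (simp add: J_J bilinear_rneg[OF b0b])
    have sy: "b0 x u = b0 u x" "b0 x (J u) = b0 u (J x)" "b0 (J x) x = b0 x (J x)"
      by (rule b0s) (rule trans[OF b0s buJ], rule b0s)
    note sm = gauss_tensor_def J_J u z sy g_J g_J_self cu bu buJ bilinear_lneg[OF b0b] bilinear_rneg[OF b0b]
      bilinear_lneg[OF cb] bilinear_rneg[OF cb] bilinear_lneg[OF g_bilinear] bilinear_rneg[OF g_bilinear]
    show ?thesis
      using shifted.kaehler[of x u u x, unfolded sm] shifted.kaehler[of x "J u" "J u" x, unfolded sm]
      by (simp add: sm)
  qed
  have "c x y = 0" for x y
    using c0[of "x + y"] c0[of x] c0[of y] cs[of x y] by (simp add: bilinear_ladd[OF cb] bilinear_radd[OF cb])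
  then show thesis by (intro that[of \<mu>]) (simp add: c_def)
qed

text \<open>With \<open>c = 0\<close> this is the Gauss equation of a Euclidean hypersurface with
  second fundamental form \<open>b - \<mu> g\<close>.\<close>

lemma gauss_tensor_isotropic:
  assumes "\<And>x y. s x y + \<mu> * b x y = \<mu>\<^sup>2 / 2 * g x y"
  shows "gauss_tensor g b s x y z w =
    (b x w - \<mu> * g x w) * (b y z - \<mu> * g y z) - (b x z - \<mu> * g x z) * (b y w - \<mu> * g y w)"
proof -
  have "gauss_tensor g b s = gauss_tensor g (\<lambda>x y. b x y - \<mu> * g x y) (\<lambda>x y. 0)"
    by (rule gauss_tensor_shift[where \<mu> = \<mu>]) (use assms in simp_all)
  then show ?thesis by (simp add: gauss_tensor_def)
qed

text \<open>An umbilic form gives constant sectional curvature \<open>(k - \<mu>)\<^sup>2\<close>,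
  which the Kaehler identity on a complex orthogonal pair equates with 0.\<close>

lemma umbilic_flat:
  assumes "\<And>x y. b x y = k * g x y"
  shows "gauss_tensor g b s x y z w = 0"
proof -
  obtain \<mu> where \<mu>: "\<And>x y. s x y + \<mu> * b x y = \<mu>\<^sup>2 / 2 * g x y"
    using isotropic_direction by blast
  obtain p where p: "g p p = 1"
    using unit_complex_orthogonal_exists by metis
  obtain u where u: "g u u = 1" "g p u = 0" "g (J p) u = 0"
    using unit_complex_orthogonal_exists[of p p p] by metis
  have z: "g p (J u) = 0" "g u (J p) = 0"
    using u g_J_swap[of p u] g_sym by (metis neg_equal_0_iff_equal)+
  have "(k - \<mu>) * (k - \<mu>) = 0"
    using kaehler[of p u u p] u z p
    unfolding gauss_tensor_isotropic[OF \<mu>] assms by (simp add: g_J_self g_sym[of u p] algebra_simps)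
  then show ?thesis
    unfolding gauss_tensor_isotropic[OF \<mu>] assms by simp
qed

end

section \<open>Differentiable families of linear equations\<close>

text \<open>Mere continuity of \<open>p\<close> suffices: \<open>q y\<close> is of order
  \<open>norm (y - x)\<close>, and the factor \<open>p y\<close> makes the product of smaller
  order.\<close>

lemma has_derivative_scaleR_vanishing:
  fixes p :: "'a::euclidean_space \<Rightarrow> real" and q :: "'a \<Rightarrow> 'b::real_normed_vector"
  assumes "isCont p x" "p x = 0" "q differentiable (at x)" "q x = 0"
  shows "((\<lambda>y. p y *\<^sub>R q y) has_derivative (\<lambda>h. 0)) (at x)"
proof -
  obtain q' where q': "(q has_derivative q') (at x)"
    using assms(3) by (auto simp: differentiable_def)
  then have bl: "bounded_linear q'"
    and lim: "((\<lambda>y. norm (q y - q x - q' (y - x)) / norm (y - x)) \<longlongrightarrow> 0) (at x)"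
    by (auto simp: has_derivative_iff_norm)
  let ?H = "\<lambda>y. \<bar>p y\<bar> * (norm (q y - q x - q' (y - x)) / norm (y - x) + onorm q')"
  have "(p \<longlongrightarrow> 0) (at x)" using assms(1,2) by (simp add: isCont_def)
  then have "((\<lambda>y. \<bar>p y\<bar>) \<longlongrightarrow> 0) (at x)" using tendsto_rabs_zero by blast
  then have "(?H \<longlongrightarrow> 0 * (0 + onorm q')) (at x)"
    by (intro tendsto_intros lim)
  then have H: "(?H \<longlongrightarrow> 0) (at x)" by simp
  show ?thesis
  proof (rule has_derivativeI_sandwich[OF zero_less_one _ _ H])
    fix y assume "y \<noteq> x"
    then have n: "norm (y - x) > 0" by simp
    have "norm (q y) \<le> norm (q y - q x - q' (y - x)) + norm (q' (y - x))"
      using assms(4) norm_triangle_sub[of "q y" "q' (y - x)"] by simp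
    also have "norm (q' (y - x)) \<le> onorm q' * norm (y - x)"
      by (rule onorm[OF bl])
    finally have "norm (q y) / norm (y - x) \<le> norm (q y - q x - q' (y - x)) / norm (y - x) + onorm q'"
      using n by (simp add: field_simps)
    then show "norm (p y *\<^sub>R q y - p x *\<^sub>R q x - 0) / norm (y - x) \<le> ?H y"
      using mult_left_mono[of _ _ "\<bar>p y\<bar>"] assms(2) by fastforce
  qed simp
qed

text \<open>Nothing is assumed about \<open>w\<close> itself. Its continuity is derived first, by
  absorbing the perturbation, and its differentiability from that.\<close>

lemma perturbed_identity_differentiable:
  fixes M :: "'a::euclidean_space \<Rightarrow> 'l::euclidean_space \<Rightarrow> 'l"
  assumes S: "open S" "x0 \<in> S"
    and lin: "\<And>x. x \<in> S \<Longrightarrow> linear (M x)"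
    and id: "\<And>z. M x0 z = z"
    and M: "\<And>z. (\<lambda>x. M x z) differentiable (at x0)"
    and C: "(\<lambda>x. M x (w x)) differentiable (at x0)"
  shows "w differentiable (at x0)"
proof -
  define E where "E x z = M x z - z" for x z
  define w0 where "w0 = w x0"
  have E0: "E x0 z = 0" for z by (simp add: E_def id)
  have Elin: "linear (E x)" if "x \<in> S" for x
    using lin[OF that] linear_compose_sub[of "M x" "\<lambda>z. z"] by (simp add: E_def[abs_def] linear_iff)
  have Ed: "(\<lambda>x. E x z) differentiable (at x0)" for z
    unfolding E_def by (intro differentiable_diff M differentiable_const)
  have Esum: "E x z = (\<Sum>i\<in>Basis. (z \<bullet> i) *\<^sub>R E x i)" if "x \<in> S" for x z
  proof -
    have "E x z = E x (\<Sum>i\<in>Basis. (z \<bullet> i) *\<^sub>R i)" by (simp add: euclidean_representation)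
    then show ?thesis
      by (simp add: linear_sum[OF Elin[OF that]] linear_scale[OF Elin[OF that]])
  qed
  define \<eta> where "\<eta> x = (\<Sum>i\<in>Basis. norm (E x i))" for x
  have Ele: "norm (E x z) \<le> norm z * \<eta> x" if "x \<in> S" for x z
  proof -
    have "norm (E x z) \<le> (\<Sum>i\<in>Basis. norm ((z \<bullet> i) *\<^sub>R E x i))"
      by (subst Esum[OF that]) (rule norm_sum)
    also have "\<dots> \<le> (\<Sum>i\<in>Basis. norm z * norm (E x i))"
      by (intro sum_mono) (simp add: mult_right_mono Basis_le_norm)
    finally show ?thesis by (simp add: \<eta>_def sum_distrib_left)
  qed
  have contE: "isCont (\<lambda>x. E x z) x0" for z
    using Ed differentiable_imp_continuous_within by blast
  have "(\<eta> \<longlongrightarrow> (\<Sum>i\<in>Basis. norm (E x0 i))) (at x0)"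
    unfolding \<eta>_def using contE unfolding isCont_def by (intro tendsto_sum tendsto_norm) auto
  then have \<eta>0: "(\<eta> \<longlongrightarrow> 0) (at x0)" by (simp add: E0)
  define K where "K x = M x (w x)" for x
  have K: "K differentiable (at x0)" "K x0 = w0" using C by (simp_all add: K_def[abs_def] id w0_def)
  have weq: "w x = K x - E x w0 - E x (w x - w0)" if "x \<in> S" for x
    using linear_diff[OF Elin[OF that], of "w x" w0] by (simp add: E_def K_def)
  have K0: "(K \<longlongrightarrow> w0) (at x0)"
    using K differentiable_imp_continuous_within[OF K(1)] by (simp add: isCont_def)
  have "((\<lambda>x. norm (K x - w0)) \<longlongrightarrow> norm (w0 - w0)) (at x0)"
    by (intro tendsto_intros K0)
  moreover have "((\<lambda>x. 2 * (norm (K x - w0) + norm w0 * \<eta> x)) \<longlongrightarrow> 2 * (norm (w0 - w0) + norm w0 * 0)) (at x0)"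
    by (intro tendsto_intros K0 \<eta>0)
  ultimately have lim: "((\<lambda>x. 2 * (norm (K x - w0) + norm w0 * \<eta> x)) \<longlongrightarrow> 0) (at x0)" by simp
  have "\<forall>\<^sub>F x in at x0. \<eta> x < 1 / 2"
    using order_tendstoD(2)[OF \<eta>0, of "1 / 2"] by simp
  moreover have "\<forall>\<^sub>F x in at x0. x \<in> S"
    using S eventually_at_topological by blast
  \<comment> \<open>Where \<open>\<eta> x < 1 / 2\<close>, the term \<open>E x (w x - w0)\<close> is
    at most half of the left side and is absorbed there; hence the factor 2.\<close>
  ultimately have "\<forall>\<^sub>F x in at x0. norm (w x - w0) \<le> 2 * (norm (K x - w0) + norm w0 * \<eta> x)"
  proof eventually_elim
    case (elim x)
    have eq: "w x - w0 = (K x - w0) - E x w0 - E x (w x - w0)"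
      using weq[OF elim(2)] by (simp add: algebra_simps)
    have "norm (w x - w0) \<le> norm (K x - w0) + norm (E x w0) + norm (E x (w x - w0))"
      using arg_cong[OF eq, of norm] norm_triangle_ineq4[of "K x - w0 - E x w0" "E x (w x - w0)"]
        norm_triangle_ineq4[of "K x - w0" "E x w0"] by linarith
    also have "\<dots> \<le> norm (K x - w0) + norm w0 * \<eta> x + norm (w x - w0) * (1 / 2)"
      using Ele[OF elim(2), of w0] Ele[OF elim(2), of "w x - w0"]
        mult_left_mono[of "\<eta> x" "1 / 2" "norm (w x - w0)"] elim(1) by simp
    finally show ?case by simp
  qed
  then have "((\<lambda>x. w x - w0) \<longlongrightarrow> 0) (at x0)"
    by (rule Lim_null_comparison[OF _ lim])
  then have contw: "isCont w x0"
    unfolding isCont_def w0_def using LIM_zero_cancel by blast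
  \<comment> \<open>In \<open>weq\<close> the last term is now a sum of products of a continuous and
    a differentiable factor, both vanishing at \<open>x0\<close>.\<close>
  have "((\<lambda>x. ((w x - w0) \<bullet> i) *\<^sub>R E x i) has_derivative (\<lambda>h. 0)) (at x0)" for i
    by (rule has_derivative_scaleR_vanishing) (use contw Ed E0 in \<open>auto simp: w0_def intro!: continuous_intros\<close>)
  then have d: "(\<lambda>x. ((w x - w0) \<bullet> i) *\<^sub>R E x i) differentiable (at x0)" for i
    unfolding differentiable_def by blast
  have "(\<lambda>x. K x - E x w0 - (\<Sum>i\<in>Basis. ((w x - w0) \<bullet> i) *\<^sub>R E x i)) differentiable (at x0)"
    by (intro differentiable_diff K Ed differentiable_sum ballI d finite_Basis)
  moreover have "K x - E x w0 - (\<Sum>i\<in>Basis. ((w x - w0) \<bullet> i) *\<^sub>R E x i) = w x" if "x \<in> S" for x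
    using weq[OF that, symmetric] unfolding Esum[OF that, of "w x - w0"] .
  ultimately show ?thesis
    by (rule differentiable_cong_open[OF S, rotated])
qed

lemma linear_scaleR_vector: "linear h \<Longrightarrow> linear (\<lambda>z. h z *\<^sub>R a)"
  by (simp add: linear_iff scaleR_add_left)

text \<open>As in least squares, the equations are weighted by their coefficient vectors
  \<open>r i\<close> at \<open>x0\<close>; the resulting \<open>N x0\<close> is a Gram operator,
  injective by \<open>inj\<close>, and its inverse reduces the system to a perturbed identity. It
  gives regularity to objects defined pointwise by \<open>THE\<close> or
  \<open>SOME\<close>.\<close>

lemma linear_system_differentiable:
  fixes \<phi> :: "'i \<Rightarrow> 'a::euclidean_space \<Rightarrow> 'l::euclidean_space \<Rightarrow> real"
  assumes S: "open S" "x0 \<in> S" and "finite I"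
    and lin: "\<And>i x. i \<in> I \<Longrightarrow> x \<in> S \<Longrightarrow> linear (\<phi> i x)"
    and d: "\<And>i z. i \<in> I \<Longrightarrow> (\<lambda>x. \<phi> i x z) differentiable (at x0)"
    and C: "\<And>i. i \<in> I \<Longrightarrow> (\<lambda>x. \<phi> i x (w x)) differentiable (at x0)"
    and inj: "\<And>z. (\<And>i. i \<in> I \<Longrightarrow> \<phi> i x0 z = 0) \<Longrightarrow> z = 0"
  shows "w differentiable (at x0)"
proof -
  define r where "r i = (\<Sum>j\<in>Basis. \<phi> i x0 j *\<^sub>R j)" for i
  have r: "\<phi> i x0 z = r i \<bullet> z" if "i \<in> I" for i z
  proof -
    have "\<phi> i x0 z = \<phi> i x0 (\<Sum>j\<in>Basis. (z \<bullet> j) *\<^sub>R j)" by (simp add: euclidean_representation)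
    also have "\<dots> = (\<Sum>j\<in>Basis. \<phi> i x0 j * (j \<bullet> z))"
      by (simp add: linear_sum[OF lin[OF that S(2)]] linear_scale[OF lin[OF that S(2)]] inner_commute mult.commute)
    finally show ?thesis by (simp add: r_def inner_sum_left)
  qed
  define N where "N x z = (\<Sum>i\<in>I. \<phi> i x z *\<^sub>R r i)" for x z
  have Nlin: "linear (N x)" if "x \<in> S" for x
    unfolding N_def by (intro linear_compose_sum ballI linear_scaleR_vector lin that)
  have "z = 0" if "N x0 z = 0" for z
  proof -
    have "(\<Sum>i\<in>I. (r i \<bullet> z) * (r i \<bullet> z)) = N x0 z \<bullet> z"
      by (simp add: N_def inner_sum_left r)
    then have "\<forall>i\<in>I. (r i \<bullet> z) * (r i \<bullet> z) = 0"
      using sum_nonneg_eq_0_iff[OF \<open>finite I\<close>, of "\<lambda>i. (r i \<bullet> z) * (r i \<bullet> z)"] that by simp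
    then show ?thesis by (intro inj) (simp add: r)
  qed
  then have "inj (N x0)"
    using linear_injective_0[OF Nlin[OF S(2)]] by blast
  then obtain N' where N': "linear N'" "\<And>z. N' (N x0 z) = z"
    using linear_injective_left_inverse[OF Nlin[OF S(2)]] by (metis comp_apply id_apply)
  have bl: "bounded_linear N'" using N'(1) linear_conv_bounded_linear by blast
  have comp: "(\<lambda>x. N' (h x)) differentiable (at x0)" if "h differentiable (at x0)" for h :: "'a \<Rightarrow> 'l"
    using that bounded_linear.has_derivative[OF bl] unfolding differentiable_def by blast
  show ?thesis
  proof (rule perturbed_identity_differentiable[OF S, of "\<lambda>x z. N' (N x z)"])
    show "linear (\<lambda>z. N' (N x z))" if "x \<in> S" for x
      using linear_compose[OF Nlin[OF that] N'(1)] by (simp add: o_def)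
    show "(\<lambda>x. N' (N x z)) differentiable at x0" for z
      unfolding N_def by (intro comp differentiable_sum \<open>finite I\<close> ballI differentiable_scaleR d differentiable_const)
    show "(\<lambda>x. N' (N x (w x))) differentiable at x0"
      unfolding N_def by (intro comp differentiable_sum \<open>finite I\<close> ballI differentiable_scaleR C differentiable_const)
  qed (rule N'(2))
qed

lemma linear_family_expand:
  fixes T :: "'a \<Rightarrow> 'e::euclidean_space \<Rightarrow> 'b::real_vector"
  assumes "linear (T y)"
  shows "T y z = (\<Sum>i\<in>Basis. (z \<bullet> i) *\<^sub>R T y i)"
proof -
  have "T y z = T y (\<Sum>i\<in>Basis. (z \<bullet> i) *\<^sub>R i)" by (simp add: euclidean_representation)
  then show ?thesis by (simp add: linear_sum[OF assms] linear_scale[OF assms])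
qed

text \<open>A product rule for operators known to be differentiable only on each fixed vector;
  expansion in \<open>Basis\<close> reduces it to finitely many products.\<close>

lemma has_derivative_linear_family:
  fixes T :: "'a::euclidean_space \<Rightarrow> 'e::euclidean_space \<Rightarrow> 'b::real_normed_vector"
  assumes S: "open S" "x \<in> S" and lin: "\<And>y. y \<in> S \<Longrightarrow> linear (T y)"
    and T: "\<And>e. (\<lambda>y. T y e) differentiable (at x)" and z: "z differentiable (at x)"
  shows "((\<lambda>y. T y (z y)) has_derivative (\<lambda>v. dir v (\<lambda>y. T y (z x)) x + T x (dir v z x))) (at x)"
proof -
  have 1: "((\<lambda>y. (\<Sum>i\<in>Basis. (z y \<bullet> i) *\<^sub>R T y i)) has_derivative
      (\<lambda>v. \<Sum>i\<in>Basis. (z x \<bullet> i) *\<^sub>R dir v (\<lambda>y. T y i) x + (dir v z x \<bullet> i) *\<^sub>R T x i)) (at x)"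
    by (intro has_derivative_sum has_derivative_scaleR has_derivative_inner_left has_derivative_dir T z)
  have 2: "((\<lambda>y. (\<Sum>i\<in>Basis. (z x \<bullet> i) *\<^sub>R T y i)) has_derivative
      (\<lambda>v. \<Sum>i\<in>Basis. (z x \<bullet> i) *\<^sub>R dir v (\<lambda>y. T y i) x)) (at x)"
    by (intro has_derivative_sum has_derivative_scaleR_right has_derivative_dir T)
  have "dir v (\<lambda>y. T y (z x)) x = (\<Sum>i\<in>Basis. (z x \<bullet> i) *\<^sub>R dir v (\<lambda>y. T y i) x)" for v
    using dir_cong[OF S, of "\<lambda>y. T y (z x)" "\<lambda>y. (\<Sum>i\<in>Basis. (z x \<bullet> i) *\<^sub>R T y i)" v]
      linear_family_expand[where T = T, OF lin] dir_eq[OF 2, of v] by simp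
  then have "(\<Sum>i\<in>Basis. (z x \<bullet> i) *\<^sub>R dir v (\<lambda>y. T y i) x + (dir v z x \<bullet> i) *\<^sub>R T x i)
      = dir v (\<lambda>y. T y (z x)) x + T x (dir v z x)" for v
    using linear_family_expand[where T = T, OF lin[OF S(2)], of "dir v z x"] by (simp add: sum.distrib)
  then have "((\<lambda>y. (\<Sum>i\<in>Basis. (z y \<bullet> i) *\<^sub>R T y i)) has_derivative
      (\<lambda>v. dir v (\<lambda>y. T y (z x)) x + T x (dir v z x))) (at x)"
    using 1 by simp
  then show ?thesis
    by (rule has_derivative_transform_within_open[OF _ S]) (use linear_family_expand[where T = T, OF lin] in simp)
qed

section \<open>Isometric immersions into flat spaces\<close>

lemma (in positive_form) riesz:
  fixes h :: "'e \<Rightarrow> real"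
  assumes "linear h"
  obtains z where "\<And>w. g z w = h w"
proof -
  define A where "A z = (\<Sum>i\<in>Basis. g z i *\<^sub>R i)" for z
  have lin: "linear (g a)" "linear (\<lambda>x. g x a)" for a
    using g_bilinear by (simp_all add: bilinear_def)
  have A: "g z w = A z \<bullet> w" for z w
    using linear_family_expand[where T = g, OF lin(1), of z w]
    by (simp add: A_def inner_sum_left) (simp add: inner_commute mult.commute)
  have "linear A"
    unfolding A_def by (intro linear_compose_sum ballI linear_scaleR_vector lin)
  moreover have "z = 0" if "A z = 0" for z
    using that by (intro eq_zero_if_orthogonal) (simp add: A)
  ultimately have "surj A"
    using linear_injective_0 linear_injective_imp_surjective by blast
  moreover obtain r where "\<And>u. h u = r \<bullet> u"
    using linear_functional_eq_inner[OF assms] by blast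
  ultimately show thesis using that A by (metis surjD)
qed

text \<open>\<open>Q\<close> may be indefinite: only the metric induced through \<open>F\<close> has
  to be positive, as for a lift into Lorentz space.\<close>

locale flat_immersion = Q: bounded_bilinear Q
  for Q :: "'l::euclidean_space \<Rightarrow> 'l \<Rightarrow> real" +
  fixes U :: "'e::euclidean_space set" and g :: "'e \<Rightarrow> 'e \<Rightarrow> 'e \<Rightarrow> real" and F :: "'e \<Rightarrow> 'l"
  assumes U: "open U"
    and Q_sym: "Q a c = Q c a"
    and F_smooth: "smooth_on U F"
    and g_positive: "x \<in> U \<Longrightarrow> positive_form (g x)"
    and F_metric: "x \<in> U \<Longrightarrow> Q (dir u F x) (dir v F x) = g x u v"
begin

abbreviation F1 where "F1 u \<equiv> dir u F"
abbreviation F2 where "F2 u v \<equiv> dir u (dir v F)"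

lemmas F_diff = smooth_on_differentiable[OF F_smooth]
  smooth_on_differentiable[OF smooth_on_dir[OF F_smooth]]
  smooth_on_differentiable[OF smooth_on_dir[OF smooth_on_dir[OF F_smooth]]]

lemma g_bilinear: "x \<in> U \<Longrightarrow> bilinear (g x)"
  using g_positive positive_form.g_bilinear by blast

lemma g_sym: "x \<in> U \<Longrightarrow> g x u v = g x v u"
  using g_positive positive_form.g_sym by blast

lemma F1_linear: "x \<in> U \<Longrightarrow> linear (\<lambda>u. F1 u x)"
  by (simp add: F_diff dir_linear)

lemma F2_sym: "x \<in> U \<Longrightarrow> F2 u v x = F2 v u x"
  by (rule dir_commute[OF U F_smooth])

lemma F2_bilinear: "x \<in> U \<Longrightarrow> bilinear (\<lambda>u v. F2 u v x)"
  using F_diff(2) dir_linear[of "F1 _" x] F2_sym[of x] by (simp add: bilinear_def)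

lemma Q_linear: "linear (\<lambda>z. Q z a)" "linear (Q a)"
  using Q.bounded_linear_left Q.bounded_linear_right bounded_linear.linear by blast+

lemma Q_F1_linear: "x \<in> U \<Longrightarrow> linear (\<lambda>w. Q a (F1 w x))"
  using linear_compose[OF F1_linear Q_linear(2)] by (simp add: o_def)

lemma dir_Q:
  assumes "a differentiable (at x)" "c differentiable (at x)"
  shows "dir v (\<lambda>y. Q (a y) (c y)) x = Q (a x) (dir v c x) + Q (dir v a x) (c x)"
  using Q.dir_prod[OF assms] .

lemma dir_g:
  assumes "x \<in> U"
  shows "dir u (\<lambda>y. g y v w) x = Q (F1 v x) (F2 u w x) + Q (F2 u v x) (F1 w x)"
proof -
  have "dir u (\<lambda>y. g y v w) x = dir u (\<lambda>y. Q (F1 v y) (F1 w y)) x"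
    by (rule dir_cong[OF U assms]) (simp add: F_metric)
  then show ?thesis by (simp add: dir_Q F_diff assms)
qed

lemma g_differentiable: "x \<in> U \<Longrightarrow> (\<lambda>y. g y v w) differentiable (at x)"
  by (rule differentiable_cong_open[OF U, of _ "\<lambda>y. Q (F1 v y) (F1 w y)"])
    (simp_all add: F_metric Q.differentiable_prod F_diff)

text \<open>For an induced metric the symmetry of \<open>F2\<close> collapses the Koszul formula:
  the Levi-Civita derivative is the tangential part of \<open>F2\<close>.\<close>

lemma christoffel_inner:
  assumes "x \<in> U"
  shows "g x (christoffel g x u v) w = Q (F2 u v x) (F1 w x)"
proof -
  interpret positive_form "g x" by (rule g_positive[OF assms])
  obtain z where z: "\<And>w. g x z w = Q (F2 u v x) (F1 w x)"
    using riesz[OF Q_F1_linear[OF assms]] by metis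
  have rhs: "frechet_derivative (\<lambda>y. g y v w) (at x) u + frechet_derivative (\<lambda>y. g y u w) (at x) v
      - frechet_derivative (\<lambda>y. g y u v) (at x) w = 2 * Q (F2 u v x) (F1 w x)" for w
    unfolding dir_def[symmetric] dir_g[OF assms]
    using F2_sym[OF assms, of v u] F2_sym[OF assms, of w v] F2_sym[OF assms, of w u] Q_sym[of "F1 v x"]
    by simp
  have "christoffel g x u v = z"
    unfolding christoffel_def rhs
  proof (rule the_equality)
    show "\<forall>w. 2 * g x z w = 2 * Q (F2 u v x) (F1 w x)" by (simp add: z)
    show "y = z" if "\<forall>w. 2 * g x y w = 2 * Q (F2 u v x) (F1 w x)" for y
      using eq_zero_if_orthogonal[of "y - z"] that z by (simp add: bilinear_lsub[OF g_bilinear])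
  qed
  then show ?thesis by (simp add: z)
qed

lemma g_eqI:
  assumes "x \<in> U" "\<And>w. g x y w = g x z w"
  shows "y = z"
  using positive_form.eq_zero_if_orthogonal[OF g_positive[OF assms(1)], of "y - z"] assms(2)
  by (simp add: bilinear_lsub[OF g_bilinear[OF assms(1)]])

lemma christoffel_linear:
  assumes "x \<in> U"
  shows "linear (\<lambda>v. christoffel g x u v)"
proof -
  note b = F2_bilinear[OF assms]
  have add: "F2 u (v + v') x = F2 u v x + F2 u v' x" for v v' using bilinear_radd[OF b] .
  have scale: "F2 u (c *\<^sub>R v) x = c *\<^sub>R F2 u v x" for c v using bilinear_rmul[OF b] .
  show ?thesis
    unfolding linear_iff
    by (intro conjI allI; rule g_eqI[OF assms])
      (simp_all add: christoffel_inner[OF assms] add scale bilinear_ladd[OF g_bilinear[OF assms]]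
        bilinear_lmul[OF g_bilinear[OF assms]] Q.add_left Q.scaleR_left)
qed

lemma christoffel_differentiable:
  assumes "x \<in> U"
  shows "(\<lambda>y. christoffel g y u v) differentiable (at x)"
proof (rule linear_system_differentiable[OF U assms finite_Basis, of "\<lambda>i x z. g x z i"])
  show "linear (\<lambda>z. g x z i)" if "x \<in> U" for i x
    using g_bilinear[OF that] by (simp add: bilinear_def)
  show "(\<lambda>x. g x z i) differentiable at x" for z i by (rule g_differentiable[OF assms])
  show "(\<lambda>x. g x (christoffel g x u v) i) differentiable at x" for i
    by (rule differentiable_cong_open[OF U assms, of "\<lambda>x. Q (F2 u v x) (F1 i x)"])
      (simp_all add: christoffel_inner Q.differentiable_prod F_diff assms)
  show "z = 0" if "\<And>i. i \<in> Basis \<Longrightarrow> g x z i = 0" for z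
  proof -
    have "g x z w = 0" for w
      using linear_family_expand[where T = "g x", of z w] g_bilinear[OF assms] that by (simp add: bilinear_def)
    then show ?thesis using positive_form.eq_zero_if_orthogonal[OF g_positive[OF assms]] by blast
  qed
qed

section \<open>Second fundamental form and Gauss equation\<close>

definition second_form :: "'e \<Rightarrow> 'e \<Rightarrow> 'e \<Rightarrow> 'l" where
  "second_form x u v = F2 u v x - F1 (christoffel g x u v) x"

lemma second_form_normal: "x \<in> U \<Longrightarrow> Q (second_form x u v) (F1 w x) = 0"
  by (simp add: second_form_def Q.diff_left F_metric christoffel_inner)

text \<open>This is \<open>christoffel_inner\<close>, differentiated. The remaining third derivative
  of \<open>F\<close> is symmetric in \<open>u\<close> and \<open>v\<close> and drops out of the
  curvature.\<close>

lemma gauss_half: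
  assumes "x \<in> U"
  shows "g x (dir u (\<lambda>y. christoffel g y v w) x + christoffel g x u (christoffel g x v w)) z =
    Q (second_form x v w) (second_form x u z) + Q (dir u (F2 v w) x) (F1 z x)"
proof -
  have lin: "linear (\<lambda>a. g y a z)" if "y \<in> U" for y
    using g_bilinear[OF that] by (simp add: bilinear_def)
  let ?G = "christoffel g x v w"
  have "dir u (\<lambda>y. g y (christoffel g y v w) z) x = dir u (\<lambda>y. g y ?G z) x + g x (dir u (\<lambda>y. christoffel g y v w) x) z"
    by (rule dir_eq, rule has_derivative_linear_family[OF U assms, of "\<lambda>y a. g y a z"])
      (simp_all add: lin g_differentiable christoffel_differentiable assms)
  moreover have "dir u (\<lambda>y. g y (christoffel g y v w) z) x = dir u (\<lambda>y. Q (F2 v w y) (F1 z y)) x"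
    by (rule dir_cong[OF U assms]) (simp add: christoffel_inner)
  moreover have "dir u (\<lambda>y. Q (F2 v w y) (F1 z y)) x = Q (F2 v w x) (F2 u z x) + Q (dir u (F2 v w) x) (F1 z x)"
    by (simp add: dir_Q F_diff assms)
  moreover have "dir u (\<lambda>y. g y ?G z) x = Q (F1 ?G x) (F2 u z x) + g x (christoffel g x u ?G) z"
    by (simp add: dir_g christoffel_inner assms)
  moreover have "Q (F2 v w x) (F2 u z x) - Q (F1 ?G x) (F2 u z x) = Q (second_form x v w) (second_form x u z)"
  proof -
    have "Q (second_form x v w) (second_form x u z) = Q (second_form x v w) (F2 u z x)"
      using second_form_normal[OF assms, of v w "christoffel g x u z"]
      by (simp add: second_form_def[of x u z] Q.diff_right)
    then show ?thesis by (simp add: second_form_def Q.diff_left)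
  qed
  ultimately show ?thesis
    by (simp add: bilinear_ladd[OF g_bilinear[OF assms]])
qed

theorem gauss_equation:
  assumes "x \<in> U"
  shows "g x (curvature g x u v w) z =
    Q (second_form x v w) (second_form x u z) - Q (second_form x u w) (second_form x v z)"
proof -
  have "curvature g x u v w =
      (dir u (\<lambda>y. christoffel g y v w) x + christoffel g x u (christoffel g x v w))
      - (dir v (\<lambda>y. christoffel g y u w) x + christoffel g x v (christoffel g x u w))"
    by (simp add: curvature_def dir_def)
  moreover have "dir u (F2 v w) x = dir v (F2 u w) x"
    by (rule dir_commute[OF U smooth_on_dir[OF F_smooth] assms])
  ultimately show ?thesis
    using gauss_half[OF assms, of u v w z] gauss_half[OF assms, of v u w z]
    by (simp add: bilinear_lsub[OF g_bilinear[OF assms]])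
qed

lemma second_form_continuous:
  assumes "x \<in> U"
  shows "isCont (\<lambda>y. second_form y u v) x"
proof -
  have "(\<lambda>y. F1 (christoffel g y u v) y) differentiable (at x)"
    using has_derivative_linear_family[OF U assms, of "\<lambda>y u. F1 u y" "\<lambda>y. christoffel g y u v",
        OF F1_linear F_diff(2)[OF assms] christoffel_differentiable[OF assms]]
    unfolding differentiable_def by blast
  then have "(\<lambda>y. second_form y u v) differentiable (at x)"
    unfolding second_form_def by (intro differentiable_diff F_diff assms)
  then show ?thesis using differentiable_imp_continuous_within by blast
qed

text \<open>Differentiability of \<open>christoffel\<close> does not make its derivatives
  continuous. The Gauss equation does give continuity, once the curvature is paired with the fixed
  vector \<open>?z\<close>.\<close>

lemma curvature_nonzero_open:
  assumes "x \<in> U" "curvature g x u v w \<noteq> 0"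
  obtains V where "open V" "x \<in> V" "V \<subseteq> U" "\<And>y. y \<in> V \<Longrightarrow> curvature g y u v w \<noteq> 0"
proof -
  let ?z = "curvature g x u v w"
  define h where "h y = Q (second_form y v w) (second_form y u ?z) - Q (second_form y u w) (second_form y v ?z)" for y
  have "isCont h x"
    unfolding h_def by (intro continuous_intros Q.continuous second_form_continuous assms)
  moreover have "h x \<noteq> 0"
    using gauss_equation[OF assms(1), of u v w ?z] positive_form.g_pos[OF g_positive[OF assms(1)] assms(2)]
    by (simp add: h_def)
  ultimately have "\<forall>\<^sub>F y in nhds x. h y \<noteq> 0"
    using tendsto_imp_eventually_ne[of h "h x" "at x" 0] by (simp add: eventually_nhds_conv_at isCont_def)
  then obtain V where V: "open V" "x \<in> V" "\<And>y. y \<in> V \<Longrightarrow> h y \<noteq> 0"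
    unfolding eventually_nhds by blast
  have "curvature g y u v w \<noteq> 0" if "y \<in> V \<inter> U" for y
    using V(3)[of y] that gauss_equation[of y u v w ?z] bilinear_lzero[OF g_bilinear[of y]] by (force simp: h_def)
  then show ?thesis
    using that[of "V \<inter> U"] V U assms(1) by auto
qed

end

section \<open>Kaehler manifolds in the light cone\<close>

text \<open>The normal space has dimension three and contains \<open>F x\<close> itself.
  \<open>frame\<close> completes it at each point separately, with no smooth dependence; its last
  clause says that frame and tangent vectors exhaust the ambient space.\<close>

locale light_cone_kaehler = flat_immersion Q U g F
  for Q :: "'l::euclidean_space \<Rightarrow> 'l \<Rightarrow> real" and U :: "'e::euclidean_space set" and g F +
  fixes J :: "'e \<Rightarrow> 'e \<Rightarrow> 'e"
  assumes dim: "DIM('e) \<ge> 8"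
    and hermitian: "x \<in> U \<Longrightarrow> hermitian_form (g x) (J x)"
    and J_smooth: "smooth_on U (\<lambda>x. J x u)"
    and J_parallel: "x \<in> U \<Longrightarrow> covariant_derivative_endo g J x u v = 0"
    and F_null: "x \<in> U \<Longrightarrow> Q (F x) (F x) = 0"
    and frame: "x \<in> U \<Longrightarrow> \<exists>\<xi> \<zeta>. Q \<xi> \<xi> = 1 \<and> Q \<zeta> \<zeta> = 0 \<and> Q \<zeta> \<xi> = 0 \<and>
      Q \<xi> (F x) = 0 \<and> Q \<zeta> (F x) = 1 \<and> (\<forall>u. Q \<xi> (dir u F x) = 0) \<and> (\<forall>u. Q \<zeta> (dir u F x) = 0) \<and>
      (\<forall>z. Q z (F x) = 0 \<and> Q z \<xi> = 0 \<and> Q z \<zeta> = 0 \<and> (\<forall>u. Q z (dir u F x) = 0) \<longrightarrow> z = 0)"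
begin

lemma J_linear: "x \<in> U \<Longrightarrow> linear (J x)"
  using hermitian hermitian_form.J_linear by blast

lemma dir_J:
  assumes "x \<in> U"
  shows "dir u (\<lambda>y. J y v) x = J x (christoffel g x u v) - christoffel g x u (J x v)"
  using J_parallel[OF assms, of u v] by (simp add: covariant_derivative_endo_def dir_def algebra_simps)

text \<open>The integrability condition of the equation for parallel \<open>J\<close>:
  \<open>dir_J\<close> expresses first derivatives of \<open>J\<close> by Christoffel terms, and its
  mixed second derivatives commute.\<close>

lemma curvature_J:
  assumes x: "x \<in> U"
  shows "curvature g x u v (J x w) = J x (curvature g x u v w)"
proof -
  define \<Gamma> where "\<Gamma> = christoffel g x"
  define D where "D a v w = dir a (\<lambda>y. christoffel g y v w) x" for a v w
  have Jd: "(\<lambda>y. J y w) differentiable (at x)" for w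
    by (rule smooth_on_differentiable[OF J_smooth x])
  have second: "dir a (dir v (\<lambda>y. J y w)) x =
      J x (\<Gamma> a (\<Gamma> v w)) - \<Gamma> a (J x (\<Gamma> v w)) + J x (D a v w)
      - (D a v (J x w) + \<Gamma> v (J x (\<Gamma> a w)) - \<Gamma> v (\<Gamma> a (J x w)))" for a v
  proof -
    have 1: "((\<lambda>y. J y (christoffel g y v w)) has_derivative
        (\<lambda>a. dir a (\<lambda>y. J y (christoffel g x v w)) x + J x (dir a (\<lambda>y. christoffel g y v w) x))) (at x)"
      by (rule has_derivative_linear_family[OF U x]) (simp_all add: J_linear Jd christoffel_differentiable x)
    have 2: "((\<lambda>y. christoffel g y v (J y w)) has_derivative
        (\<lambda>a. dir a (\<lambda>y. christoffel g y v (J x w)) x + christoffel g x v (dir a (\<lambda>y. J y w) x))) (at x)"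
      by (rule has_derivative_linear_family[OF U x]) (simp_all add: christoffel_linear Jd christoffel_differentiable x)
    have "dir a (dir v (\<lambda>y. J y w)) x = dir a (\<lambda>y. J y (christoffel g y v w) - christoffel g y v (J y w)) x"
      by (rule dir_cong[OF U x]) (rule dir_J)
    also have "\<dots> = dir a (\<lambda>y. J y (christoffel g x v w)) x + J x (dir a (\<lambda>y. christoffel g y v w) x)
        - (dir a (\<lambda>y. christoffel g y v (J x w)) x + christoffel g x v (dir a (\<lambda>y. J y w) x))"
      by (rule dir_eq[OF has_derivative_diff[OF 1 2]])
    finally show ?thesis
      by (simp add: dir_J[OF x] \<Gamma>_def D_def linear_diff[OF christoffel_linear[OF x]])
  qed
  have "dir u (dir v (\<lambda>y. J y w)) x = dir v (dir u (\<lambda>y. J y w)) x"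
    by (rule dir_commute[OF U J_smooth x])
  then have "J x (D u v w) - J x (D v u w) + J x (\<Gamma> u (\<Gamma> v w)) - J x (\<Gamma> v (\<Gamma> u w)) =
      D u v (J x w) - D v u (J x w) + \<Gamma> u (\<Gamma> v (J x w)) - \<Gamma> v (\<Gamma> u (J x w))"
    unfolding second by (simp add: algebra_simps)
  then show ?thesis
    unfolding curvature_def dir_def[symmetric] D_def[symmetric] \<Gamma>_def[symmetric]
    by (simp add: linear_diff[OF J_linear[OF x]] linear_add[OF J_linear[OF x]])
qed

section \<open>Normal frames and curvature in the light cone\<close>

lemma F_F1:
  assumes "x \<in> U"
  shows "Q (F x) (F1 u x) = 0"
proof -
  have "dir u (\<lambda>y. Q (F y) (F y)) x = dir u (\<lambda>y. 0) x"
    by (rule dir_cong[OF U assms]) (rule F_null)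
  then show ?thesis
    using Q_sym[of "F1 u x" "F x"] by (simp add: dir_Q F_diff assms dir_const)
qed

lemma F_F2:
  assumes "x \<in> U"
  shows "Q (F x) (F2 u v x) = - g x u v"
proof -
  have "dir u (\<lambda>y. Q (F y) (F1 v y)) x = dir u (\<lambda>y. 0) x"
    by (rule dir_cong[OF U assms]) (rule F_F1)
  then show ?thesis
    by (simp add: dir_Q F_diff F_metric assms dir_const algebra_simps)
qed

definition null_frame :: "'e \<Rightarrow> 'l \<Rightarrow> 'l \<Rightarrow> bool" where
  "null_frame x \<xi> \<zeta> \<longleftrightarrow> Q \<xi> \<xi> = 1 \<and> Q \<zeta> \<zeta> = 0 \<and> Q \<zeta> \<xi> = 0 \<and>
      Q \<xi> (F x) = 0 \<and> Q \<zeta> (F x) = 1 \<and> (\<forall>u. Q \<xi> (F1 u x) = 0) \<and> (\<forall>u. Q \<zeta> (F1 u x) = 0) \<and>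
      (\<forall>z. Q z (F x) = 0 \<and> Q z \<xi> = 0 \<and> Q z \<zeta> = 0 \<and> (\<forall>u. Q z (F1 u x) = 0) \<longrightarrow> z = 0)"

lemma null_frameD:
  assumes "null_frame x \<xi> \<zeta>"
  shows "Q \<xi> \<xi> = 1" "Q \<zeta> \<zeta> = 0" "Q \<zeta> \<xi> = 0" "Q \<xi> \<zeta> = 0" "Q \<xi> (F x) = 0" "Q (F x) \<xi> = 0"
    "Q \<zeta> (F x) = 1" "Q (F x) \<zeta> = 1" "Q \<xi> (F1 u x) = 0" "Q (F1 u x) \<xi> = 0" "Q \<zeta> (F1 u x) = 0" "Q (F1 u x) \<zeta> = 0"
  using assms Q_sym unfolding null_frame_def by metis+

lemma normal_expansion:
  assumes x: "x \<in> U" and fr: "null_frame x \<xi> \<zeta>" and a: "\<And>u. Q a (F1 u x) = 0"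
  shows "a = Q a (F x) *\<^sub>R \<zeta> + Q a \<xi> *\<^sub>R \<xi> + Q a \<zeta> *\<^sub>R F x"
proof -
  let ?z = "a - (Q a (F x) *\<^sub>R \<zeta> + Q a \<xi> *\<^sub>R \<xi> + Q a \<zeta> *\<^sub>R F x)"
  have "Q ?z (F x) = 0" "Q ?z \<xi> = 0" "Q ?z \<zeta> = 0" "\<And>u. Q ?z (F1 u x) = 0"
    using F_null[OF x] F_F1[OF x] a null_frameD[OF fr]
    by (simp_all add: Q.diff_left Q.add_left Q.scaleR_left)
  then have "?z = 0" using fr unfolding null_frame_def by blast
  then show ?thesis by simp
qed

lemma normal_inner:
  assumes x: "x \<in> U" and fr: "null_frame x \<xi> \<zeta>"
    and a: "\<And>u. Q a (F1 u x) = 0" and c: "\<And>u. Q c (F1 u x) = 0"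
  shows "Q a c = Q a (F x) * Q c \<zeta> + Q a \<xi> * Q c \<xi> + Q a \<zeta> * Q c (F x)"
proof -
  have "Q a c = Q (Q a (F x) *\<^sub>R \<zeta> + Q a \<xi> *\<^sub>R \<xi> + Q a \<zeta> *\<^sub>R F x) c"
    using normal_expansion[OF x fr a] by simp
  then show ?thesis
    by (simp add: Q.add_left Q.scaleR_left Q_sym[of \<zeta> c] Q_sym[of \<xi> c] Q_sym[of "F x" c])
qed

text \<open>\<open>F x\<close> and \<open>\<zeta>\<close> are null with product 1, so their
  components enter as cross terms, in which the signs of \<open>-g\<close> and \<open>-s\<close>
  cancel.\<close>

lemma curvature_eq_gauss_tensor:
  assumes x: "x \<in> U" and fr: "null_frame x \<xi> \<zeta>"
  shows "g x (curvature g x u v w) z =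
    gauss_tensor (g x) (\<lambda>u v. Q (F2 u v x) \<xi>) (\<lambda>u v. - Q (F2 u v x) \<zeta>) u v w z"
proof -
  have sf: "Q (second_form x u v) (F x) = - g x u v" "Q (second_form x u v) \<xi> = Q (F2 u v x) \<xi>"
    "Q (second_form x u v) \<zeta> = Q (F2 u v x) \<zeta>" for u v
    using F_F2[OF x, of u v] F_F1[OF x] null_frameD[OF fr] Q_sym[of "second_form x u v" "F x"]
    by (simp_all add: second_form_def Q.diff_left Q.diff_right)
  show ?thesis
    unfolding gauss_equation[OF x] normal_inner[OF x fr second_form_normal[OF x] second_form_normal[OF x]] sf
    by (simp add: gauss_tensor_def algebra_simps)
qed

lemma kaehler_gauss:
  assumes x: "x \<in> U" and fr: "null_frame x \<xi> \<zeta>"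
  shows "kaehler_gauss (g x) (J x) (\<lambda>u v. Q (F2 u v x) \<xi>) (\<lambda>u v. - Q (F2 u v x) \<zeta>)"
proof -
  interpret hermitian_form "g x" "J x" by (rule hermitian[OF x])
  note b = F2_bilinear[OF x]
  have lin: "linear (\<lambda>v. Q (F2 u v x) a)" "linear (\<lambda>u. Q (F2 u v x) a)"
    "linear (\<lambda>v. - Q (F2 u v x) a)" "linear (\<lambda>u. - Q (F2 u v x) a)" for u v a
    using bilinear_ladd[OF b] bilinear_radd[OF b] bilinear_lmul[OF b] bilinear_rmul[OF b]
    by (simp_all add: linear_iff Q.add_left Q.scaleR_left)
  show ?thesis
  proof
    fix y z v w
    show "gauss_tensor (g x) (\<lambda>u v. Q (F2 u v x) \<xi>) (\<lambda>u v. - Q (F2 u v x) \<zeta>) y z (J x v) (J x w) =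
      gauss_tensor (g x) (\<lambda>u v. Q (F2 u v x) \<xi>) (\<lambda>u v. - Q (F2 u v x) \<zeta>) y z v w"
      unfolding curvature_eq_gauss_tensor[OF x fr, symmetric] curvature_J[OF x] g_J ..
  qed (use dim lin F2_sym[OF x] in \<open>auto simp: bilinear_def\<close>)
qed

section \<open>Null normals orthogonal to the second fundamental form\<close>

definition isotropic :: "'e \<Rightarrow> 'l \<Rightarrow> bool" where
  "isotropic x w \<longleftrightarrow> Q w w = 0 \<and> Q w (F x) = 1 \<and> (\<forall>u. Q w (F1 u x) = 0) \<and> (\<forall>u v. Q w (F2 u v x) = 0)"

lemma isotropic_exists:
  assumes x: "x \<in> U"
  obtains w where "isotropic x w"
proof -
  obtain \<xi> \<zeta> where fr: "null_frame x \<xi> \<zeta>"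
    using frame[OF x] unfolding null_frame_def by blast
  interpret kaehler_gauss "g x" "J x" "\<lambda>u v. Q (F2 u v x) \<xi>" "\<lambda>u v. - Q (F2 u v x) \<zeta>"
    by (rule kaehler_gauss[OF x fr])
  obtain \<mu> where \<mu>: "\<And>u v. - Q (F2 u v x) \<zeta> + \<mu> * Q (F2 u v x) \<xi> = \<mu>\<^sup>2 / 2 * g x u v"
    using isotropic_direction by blast
  \<comment> \<open>The equation for \<open>\<mu>\<close> says that \<open>?w\<close> is orthogonal
    to \<open>F2\<close>; the coefficient \<open>\<mu>\<^sup>2 / 2\<close> is also the one that
    makes \<open>?w\<close> null.\<close>
  let ?w = "\<zeta> - \<mu> *\<^sub>R \<xi> - (\<mu>\<^sup>2 / 2) *\<^sub>R F x"
  have "Q ?w (F2 u v x) = 0" for u v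
    using \<mu>[of u v] F_F2[OF x, of u v] Q_sym[of \<zeta>] Q_sym[of \<xi>]
    by (simp add: Q.diff_left Q.scaleR_left)
  then have "isotropic x ?w"
    using F_null[OF x] F_F1[OF x] null_frameD[OF fr]
    by (simp add: isotropic_def Q.diff_left Q.diff_right Q.scaleR_left Q.scaleR_right power2_eq_square)
  then show ?thesis by (rule that)
qed

text \<open>At a non-flat point \<open>F\<close>, \<open>F1\<close> and \<open>F2\<close> span the
  ambient space: a nonzero \<open>z\<close> would make \<open>b\<close> a multiple of
  \<open>g\<close>, against \<open>umbilic_flat\<close>. Uniqueness and regularity of isotropic
  vectors rest on this.\<close>

lemma conormal_trivial:
  assumes x: "x \<in> U" and curv: "curvature g x u0 v0 w0 \<noteq> 0"
    and z: "Q z (F x) = 0" "\<And>u. Q z (F1 u x) = 0" "\<And>u v. Q z (F2 u v x) = 0"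
  shows "z = 0"
proof -
  obtain \<xi> \<zeta> where fr: "null_frame x \<xi> \<zeta>"
    using frame[OF x] unfolding null_frame_def by blast
  interpret kaehler_gauss "g x" "J x" "\<lambda>u v. Q (F2 u v x) \<xi>" "\<lambda>u v. - Q (F2 u v x) \<zeta>"
    by (rule kaehler_gauss[OF x fr])
  have z_eq: "z = Q z \<xi> *\<^sub>R \<xi> + Q z \<zeta> *\<^sub>R F x"
    using normal_expansion[OF x fr z(2)] z(1) by simp
  have *: "Q z \<xi> * Q (F2 u v x) \<xi> = Q z \<zeta> * g x u v" for u v
  proof -
    have "Q (Q z \<xi> *\<^sub>R \<xi> + Q z \<zeta> *\<^sub>R F x) (F2 u v x) = 0"
      using z(3)[of u v] z_eq by simp
    then show ?thesis
      by (simp add: Q.add_left Q.scaleR_left F_F2[OF x] Q_sym[of \<xi>])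
  qed
  have "Q z \<xi> = 0"
  proof (rule ccontr)
    assume "Q z \<xi> \<noteq> 0"
    then have "Q (F2 u v x) \<xi> = Q z \<zeta> / Q z \<xi> * g x u v" for u v
      using *[of u v] by (simp add: field_simps)
    from umbilic_flat[OF this] have "g x (curvature g x u0 v0 w0) y = 0" for y
      unfolding curvature_eq_gauss_tensor[OF x fr] .
    then show False using curv eq_zero_if_orthogonal by blast
  qed
  moreover obtain p where "g x p p = 1"
    using unit_complex_orthogonal_exists by metis
  ultimately show "z = 0"
    using *[of p p] z_eq by simp
qed

text \<open>Codazzi: a symmetric family of conormal vectors vanishes, as \<open>b - \<mu> g\<close> has rank at least two
  where the curvature does not vanish.\<close>

lemma codazzi_trivial:
  assumes x: "x \<in> U" and curv: "curvature g x u0 v0 w0 \<noteq> 0" and w: "isotropic x w"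
    and z: "\<And>t. Q (z t) (F x) = 0" "\<And>t u. Q (z t) (F1 u x) = 0" "\<And>t. Q (z t) w = 0"
      "\<And>t u v. Q (z t) (F2 u v x) = Q (z u) (F2 t v x)"
  shows "z t = 0"
proof -
  obtain \<xi> \<zeta> where fr: "null_frame x \<xi> \<zeta>"
    using frame[OF x] unfolding null_frame_def by blast
  define b where "b u v = Q (F2 u v x) \<xi>" for u v
  define s where "s u v = - Q (F2 u v x) \<zeta>" for u v
  interpret kaehler_gauss "g x" "J x" b s
    using kaehler_gauss[OF x fr] by (simp add: b_def[abs_def] s_def[abs_def])
  have w': "Q w w = 0" "Q w (F x) = 1" "\<And>u. Q w (F1 u x) = 0" "\<And>u v. Q w (F2 u v x) = 0"
    using w by (auto simp: isotropic_def)
  \<comment> \<open>Now \<open>w\<close> is given, so \<open>\<mu>\<close> is read off from its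
    \<open>\<xi>\<close> component; nullity fixes the component along \<open>F x\<close>.\<close>
  define \<mu> where "\<mu> = - Q w \<xi>"
  have "2 * Q w \<zeta> + \<mu> * \<mu> = 0"
    using normal_inner[OF x fr w'(3) w'(3)] w' by (simp add: \<mu>_def)
  then have w\<zeta>: "Q w \<zeta> = - (\<mu>\<^sup>2 / 2)" by (simp add: power2_eq_square)
  have w_eq: "w = \<zeta> - \<mu> *\<^sub>R \<xi> - (\<mu>\<^sup>2 / 2) *\<^sub>R F x"
    using normal_expansion[OF x fr w'(3)] w'(2) w\<zeta> by (simp add: \<mu>_def)
  have iso: "s u v + \<mu> * b u v = \<mu>\<^sup>2 / 2 * g x u v" for u v
  proof -
    have "Q (\<zeta> - \<mu> *\<^sub>R \<xi> - (\<mu>\<^sup>2 / 2) *\<^sub>R F x) (F2 u v x) = 0"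
      using w'(4)[of u v] w_eq by simp
    then show ?thesis
      by (simp add: Q.diff_left Q.scaleR_left F_F2[OF x] b_def s_def Q_sym[of \<zeta>] Q_sym[of \<xi>])
  qed
  define y where "y t = Q (z t) \<xi>" for t
  \<comment> \<open>Orthogonality to \<open>F x\<close>, to the tangent space and to
    \<open>w\<close> leaves a single line in the normal space.\<close>
  have z_eq: "z t = y t *\<^sub>R (\<xi> + \<mu> *\<^sub>R F x)" for t
  proof -
    have "Q (z t) \<zeta> = \<mu> * y t"
      using normal_inner[OF x fr z(2) w'(3), of t] z(1,3)[of t] w'(2) by (simp add: \<mu>_def y_def algebra_simps)
    then show ?thesis
      using normal_expansion[OF x fr z(2), of t] z(1)[of t] by (simp add: y_def scaleR_add_right mult.commute)
  qed
  have zF2: "Q (z t) (F2 u v x) = y t * (b u v - \<mu> * g x u v)" for t u v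
    unfolding z_eq by (simp add: Q.add_left Q.scaleR_left F_F2[OF x] b_def Q_sym[of \<xi>])
  have "y t = 0" for t
  proof (rule ccontr)
    assume t: "y t \<noteq> 0"
    \<comment> \<open>By symmetry in \<open>t\<close> and \<open>u\<close>, a nonzero
      \<open>y t\<close> makes \<open>b - \<mu> g\<close> a product of functions of one vector each,
      and then the Gauss tensor vanishes.\<close>
    define c where "c v = (b t v - \<mu> * g x t v) / y t" for v
    have "b u v - \<mu> * g x u v = y u * c v" for u v
      using z(4)[of t u v] t unfolding zF2 c_def by (simp add: field_simps)
    then have "gauss_tensor (g x) b s x1 x2 x3 x4 = 0" for x1 x2 x3 x4
      unfolding gauss_tensor_isotropic[OF iso] by simp
    then have "g x (curvature g x u0 v0 w0) p = 0" for p
      unfolding curvature_eq_gauss_tensor[OF x fr] b_def[abs_def, symmetric] s_def[abs_def, symmetric] .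
    then show False using curv eq_zero_if_orthogonal by blast
  qed
  then show ?thesis by (simp add: z_eq)
qed

text \<open>Differentiating the equal products twice makes \<open>w - w'\<close> orthogonal to
  \<open>F\<close>, \<open>F1\<close> and \<open>F2\<close>. A single curved point suffices, so
  vectors from different charts can be compared.\<close>

lemma local_position_unique:
  assumes V: "open V" "V \<subseteq> U" and x: "x \<in> V" and curv: "curvature g x u0 v0 w0 \<noteq> 0"
    and w: "\<And>y. y \<in> V \<Longrightarrow> Q w (F y) = 1" "\<And>y. y \<in> V \<Longrightarrow> Q w' (F y) = 1"
  shows "w = w'"
proof -
  let ?z = "w - w'"
  have U': "y \<in> U" if "y \<in> V" for y using that V by blast
  have dirQ: "dir u (\<lambda>y. Q ?z (h y)) y = Q ?z (dir u h y)" if "h differentiable (at y)" for u h y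
    by (rule dir_bounded_linear[OF Q.bounded_linear_right that])
  have 0: "Q ?z (F y) = 0" if "y \<in> V" for y
    using w that by (simp add: Q.diff_left)
  have 1: "Q ?z (F1 u y) = 0" if "y \<in> V" for u y
    using dir_cong[OF V(1) that, of "\<lambda>y. Q ?z (F y)" "\<lambda>y. 0" u] 0 that
    by (simp add: dirQ F_diff U' dir_const)
  have 2: "Q ?z (F2 u v y) = 0" if "y \<in> V" for u v y
    using dir_cong[OF V(1) that, of "\<lambda>y. Q ?z (F1 v y)" "\<lambda>y. 0" u] 1 that
    by (simp add: dirQ F_diff U' dir_const)
  have "?z = 0"
    by (rule conormal_trivial[OF U'[OF x] curv]) (use 0 1 2 x in auto)
  then show ?thesis by simp
qed

text \<open>The products of \<open>W\<close> with \<open>F\<close>, \<open>F1\<close> and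
  \<open>F2\<close> are constants 1 or 0. Finitely many of them determine \<open>W\<close> by
  \<open>conormal_trivial\<close>, so this pointwise choice solves a linear system with
  differentiable coefficients.\<close>

lemma isotropic_differentiable:
  assumes V: "open V" "V \<subseteq> U" and x: "x \<in> V" and curv: "curvature g x u0 v0 w0 \<noteq> 0"
    and W: "\<And>y. y \<in> V \<Longrightarrow> isotropic y (W y)"
  shows "W differentiable (at x)"
proof -
  have xU: "x \<in> U" using V x by blast
  define I where "I = insert F ((\<lambda>u. F1 u) ` Basis \<union> (\<lambda>(u, v). F2 u v) ` (Basis \<times> Basis))"
  have fin: "finite I" by (simp add: I_def)
  have Id: "h differentiable (at x)" if "h \<in> I" for h
    using that xU by (auto simp: I_def F_diff)
  have const: "\<exists>c. \<forall>y\<in>V. Q (W y) (h y) = c" if "h \<in> I" for h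
  proof (cases "h = F")
    case True
    then show ?thesis using W unfolding isotropic_def by blast
  next
    case False
    then show ?thesis using that W unfolding I_def isotropic_def by (intro exI[of _ 0]) auto
  qed
  show ?thesis
  proof (rule linear_system_differentiable[OF V(1) x fin, of "\<lambda>h y z. Q z (h y)"])
    show "linear (\<lambda>z. Q z (h y))" for h y by (rule Q_linear)
    show "(\<lambda>y. Q z (h y)) differentiable at x" if "h \<in> I" for h z
      using Q.differentiable_prod[OF differentiable_const Id[OF that]] .
    show "(\<lambda>y. Q (W y) (h y)) differentiable at x" if h: "h \<in> I" for h
    proof -
      obtain c where c: "\<And>y. y \<in> V \<Longrightarrow> Q (W y) (h y) = c" using const[OF h] by blast
      show ?thesis
        by (rule differentiable_cong_open[OF V(1) x, of "\<lambda>y. c"]) (simp_all add: c)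
    qed
    fix z assume z: "\<And>h. h \<in> I \<Longrightarrow> Q z (h x) = 0"
    show "z = 0"
    proof (rule conormal_trivial[OF xU curv])
      show "Q z (F x) = 0" using z by (simp add: I_def)
      have 1: "Q z (F1 u x) = 0" if "u \<in> Basis" for u using z that by (simp add: I_def)
      show "Q z (F1 u x) = 0" for u
        using linear_family_expand[where T = "\<lambda>_ w. Q z (F1 w x)", OF Q_F1_linear[OF xU], of u] 1 by simp
      have 2: "Q z (F2 u v x) = 0" if "u \<in> Basis" "v \<in> Basis" for u v
      proof (rule z)
        show "F2 u v \<in> I"
          unfolding I_def using that by (intro insertI2 UnI2 image_eqI[of _ _ "(u, v)"]) auto
      qed
      have lin: "linear (\<lambda>u. Q z (F2 u v x))" "linear (\<lambda>v. Q z (F2 u v x))" for u v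
        using F2_bilinear[OF xU] linear_compose[OF _ Q_linear(2)[of z]]
        by (auto simp: bilinear_def o_def)
      have 3: "Q z (F2 u v x) = 0" if "u \<in> Basis" for u v
        using linear_family_expand[where T = "\<lambda>_ v. Q z (F2 u v x)", OF lin(2), of v] 2[OF that] by simp
      show "Q z (F2 u v x) = 0" for u v
        using linear_family_expand[where T = "\<lambda>_ u. Q z (F2 u v x)", OF lin(1), of u] 3 by simp
    qed
  qed
qed

text \<open>Differentiating those constant products puts the derivatives of \<open>W\<close> into
  the situation of \<open>codazzi_trivial\<close>; the required symmetry is that of third
  derivatives of \<open>F\<close>.\<close>

lemma isotropic_derivative_zero:
  assumes V: "open V" "V \<subseteq> U" and x: "x \<in> V" and curv: "curvature g x u0 v0 w0 \<noteq> 0"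
    and W: "\<And>y. y \<in> V \<Longrightarrow> isotropic y (W y)"
  shows "(W has_derivative (\<lambda>t. 0)) (at x)"
proof -
  have xU: "x \<in> U" using V x by blast
  have Wd: "W differentiable (at x)" by (rule isotropic_differentiable[OF assms])
  have rule: "Q (W x) (dir t h x) + Q (dir t W x) (h x) = 0"
    if "\<And>y. y \<in> V \<Longrightarrow> Q (W y) (h y) = c" "h differentiable (at x)" for t h c
    using dir_cong[OF V(1) x, of "\<lambda>y. Q (W y) (h y)" "\<lambda>y. c" t] that
    by (simp add: dir_Q[OF Wd that(2)] dir_const)
  have iso: "Q (W y) (W y) = 0" "Q (W y) (F y) = 1" "Q (W y) (F1 u y) = 0" "Q (W y) (F2 u v y) = 0" if "y \<in> V" for u v y
    using W[OF that] by (auto simp: isotropic_def)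
  have "dir t W x = 0" for t
  proof (rule codazzi_trivial[OF xU curv W[OF x], of "\<lambda>t. dir t W x"])
    show "Q (dir t W x) (F x) = 0" for t
      using rule[where h = F and t = t and c = 1] iso(2,3) x F_diff(1)[OF xU] by simp
    show "Q (dir t W x) (F1 u x) = 0" for t u
      using rule[where h = "F1 u" and t = t and c = 0] iso(3,4) x F_diff(2)[OF xU] by simp
    show "Q (dir t W x) (W x) = 0" for t
      using rule[where h = W and t = t and c = 0] iso(1) Wd Q_sym[of "dir t W x" "W x"] by simp
    have F3: "Q (dir t W x) (F2 u v x) = - Q (W x) (dir t (F2 u v) x)" for t u v
      using rule[where h = "F2 u v" and t = t and c = 0] iso(4) F_diff(3)[OF xU] by simp
    show "Q (dir t W x) (F2 u v x) = Q (dir u W x) (F2 t v x)" for t u v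
      unfolding F3 using dir_commute[OF U smooth_on_dir[OF F_smooth] xU, of t u v] by simp
  qed
  then show ?thesis using has_derivative_dir[OF Wd] by simp
qed

theorem local_position:
  assumes x: "x \<in> U" and curv: "curvature g x u0 v0 w0 \<noteq> 0"
  obtains V w where "open V" "x \<in> V" "V \<subseteq> U" "Q w w = 0" "\<And>y. y \<in> V \<Longrightarrow> Q w (F y) = 1"
proof -
  obtain V' where V': "open V'" "x \<in> V'" "V' \<subseteq> U" "\<And>y. y \<in> V' \<Longrightarrow> curvature g y u0 v0 w0 \<noteq> 0"
    using curvature_nonzero_open[OF assms] by blast
  then obtain e where e: "e > 0" "ball x e \<subseteq> V'"
    using open_contains_ball by blast
  \<comment> \<open>A ball is convex, so a vanishing derivative makes \<open>W\<close> constant on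
    it.\<close>
  let ?V = "ball x e"
  have V: "open ?V" "?V \<subseteq> U" "x \<in> ?V" using e V' by auto
  define W where "W y = (SOME w. isotropic y w)" for y
  have W: "isotropic y (W y)" if "y \<in> ?V" for y
  proof -
    have "y \<in> U" using that V(2) by blast
    then obtain w where "isotropic y w" by (rule isotropic_exists)
    then show ?thesis unfolding W_def by (rule someI)
  qed
  have "W y = W x" if "y \<in> ?V" for y
  proof (rule has_derivative_zero_unique[of ?V])
    show "(W has_derivative (\<lambda>t. 0)) (at y within ?V)" if "y \<in> ?V" for y
      using isotropic_derivative_zero[OF V(1,2) that V'(4) W] that e(2) has_derivative_at_withinI by blast
  qed (use that V in auto)
  then have "Q (W x) (F y) = 1" if "y \<in> ?V" for y
    using W[OF that] that unfolding isotropic_def by metis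
  moreover have "Q (W x) (W x) = 0" using W[OF V(3)] by (simp add: isotropic_def)
  ultimately show thesis using that V by blast
qed

end

section \<open>The light cone lift of a conformal immersion\<close>

text \<open>The polar form of \<open>|y|^2 - s * t\<close>, with null coordinates \<open>s\<close>,
  \<open>t\<close> in the last two places.\<close>

definition lorentz :: "'v::euclidean_space \<times> real \<times> real \<Rightarrow> 'v \<times> real \<times> real \<Rightarrow> real" where
  "lorentz z w = fst z \<bullet> fst w - (fst (snd z) * snd (snd w) + snd (snd z) * fst (snd w)) / 2"

lemma lorentz_Pair: "lorentz (a, s, t) (a', s', t') = a \<bullet> a' - (s * t' + t * s') / 2"
  by (simp add: lorentz_def)

lemma lorentz_sym: "lorentz z w = lorentz w z"
  by (simp add: lorentz_def inner_commute mult.commute)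

lemma bounded_bilinear_lorentz: "bounded_bilinear lorentz"
  unfolding bilinear_conv_bounded_bilinear[symmetric] bilinear_def linear_iff lorentz_def
  by (auto simp: inner_simps field_simps)

interpretation lorentz: bounded_bilinear lorentz
  by (rule bounded_bilinear_lorentz)

definition cone :: "'v::euclidean_space \<Rightarrow> 'v \<times> real \<times> real" where
  "cone y = (y, 1, y \<bullet> y)"

definition cone_tangent :: "'v::euclidean_space \<Rightarrow> 'v \<Rightarrow> 'v \<times> real \<times> real" where
  "cone_tangent y v = (v, 0, 2 * (y \<bullet> v))"

text \<open>\<open>cone\<close> is an isometric embedding into the light cone. Because
  \<open>cone y\<close> is null and orthogonal to its tangents, multiplying it by a function only
  scales the induced metric; the derivative of the function does not enter.\<close>

lemma lorentz_cone:
  "lorentz (cone y) (cone y) = 0"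
  "lorentz (cone y) (cone_tangent y v) = 0"
  "lorentz (cone_tangent y v) (cone y) = 0"
  "lorentz (cone_tangent y v) (cone_tangent y w) = v \<bullet> w"
  by (simp_all add: cone_def cone_tangent_def lorentz_Pair inner_commute)

lemma smooth_on_Pair:
  assumes S: "open S" and "smooth_on S f" "smooth_on S h"
  shows "smooth_on S (\<lambda>x. (f x, h x))"
proof -
  have "smooth_on S (\<lambda>x. (f x, 0) + (0, h x))"
    by (intro smooth_on_add S smooth_on_bounded_linear[OF S _ assms(2), of "\<lambda>z. (z, 0)"]
        smooth_on_bounded_linear[OF S _ assms(3), of "\<lambda>z. (0, z)"] bounded_linear_Pair
        bounded_linear_ident bounded_linear_zero)
  then show ?thesis by simp
qed

lemma has_derivative_cone:
  assumes "\<phi> differentiable (at x)"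
  shows "((\<lambda>x. cone (\<phi> x)) has_derivative (\<lambda>u. cone_tangent (\<phi> x) (dir u \<phi> x))) (at x)"
  unfolding cone_def cone_tangent_def
  by (rule derivative_eq_intros has_derivative_dir[OF assms] refl)+ (simp add: inner_commute)

lemma smooth_on_cone: "open S \<Longrightarrow> smooth_on S \<phi> \<Longrightarrow> smooth_on S (\<lambda>x. cone (\<phi> x))"
  unfolding cone_def by (intro smooth_on_Pair smooth_on_inner smooth_on_const)

lemma unit_normal_exists:
  fixes d :: "'e::euclidean_space \<Rightarrow> 'v::euclidean_space"
  assumes "linear d" "inj d" "DIM('v) = DIM('e) + 1"
  obtains \<nu> where "\<nu> \<bullet> \<nu> = 1" "\<And>u. d u \<bullet> \<nu> = 0" "\<And>a. a \<bullet> \<nu> = 0 \<Longrightarrow> (\<And>u. a \<bullet> d u = 0) \<Longrightarrow> a = 0"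
proof -
  have dim: "dim (range d) = DIM('e)"
    using dim_image_eq[OF assms(1), of UNIV] assms(2) by simp
  then obtain n where n: "n \<noteq> 0" "\<And>y. y \<in> span (range d) \<Longrightarrow> orthogonal n y"
    using orthogonal_to_subspace_exists[of "range d"] assms(3) by auto
  define \<nu> where "\<nu> = (1 / norm n) *\<^sub>R n"
  have 1: "\<nu> \<bullet> \<nu> = 1" using n(1) by (simp add: \<nu>_def dot_square_norm power2_eq_square)
  have 2: "d u \<bullet> \<nu> = 0" for u
    using n(2)[of "d u"] by (simp add: \<nu>_def span_base orthogonal_def inner_commute)
  have "n \<notin> span (range d)"
    using n(2)[of n] n(1) by (auto simp: orthogonal_def)
  then have "dim (insert n (range d)) = DIM('v)"
    using dim assms(3) by (simp add: dim_insert)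
  then have full: "span (insert n (range d)) = UNIV"
    using dim_eq_full by blast
  show thesis
  proof (rule that[OF 1 2])
    fix a assume a: "a \<bullet> \<nu> = 0" "\<And>u. a \<bullet> d u = 0"
    have "orthogonal a a"
      by (rule orthogonal_to_span[of _ "insert n (range d)"])
        (use full a n(1) in \<open>auto simp: orthogonal_def \<nu>_def\<close>)
    then show "a = 0" by (simp add: orthogonal_def)
  qed
qed

lemma light_cone_kaehler_lift:
  fixes U :: "'e::euclidean_space set" and \<phi> :: "'e \<Rightarrow> 'v::euclidean_space"
  assumes U: "open U" and dim: "DIM('e) \<ge> 8" "DIM('v) = DIM('e) + 1"
    and \<phi>: "smooth_on U \<phi>" and l: "smooth_on U l" "\<And>x. x \<in> U \<Longrightarrow> l x > 0"
    and hermitian: "\<And>x. x \<in> U \<Longrightarrow> hermitian_form (g x) (J x)"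
    and J: "\<And>u. smooth_on U (\<lambda>x. J x u)"
      "\<And>x u v. x \<in> U \<Longrightarrow> covariant_derivative_endo g J x u v = 0"
    and conf: "\<And>x u v. x \<in> U \<Longrightarrow> dir u \<phi> x \<bullet> dir v \<phi> x = (l x)\<^sup>2 * g x u v"
  shows "light_cone_kaehler lorentz U g (\<lambda>x. inverse (l x) *\<^sub>R cone (\<phi> x)) J"
proof -
  define F where "F x = inverse (l x) *\<^sub>R cone (\<phi> x)" for x
  have pos: "positive_form (g x)" if "x \<in> U" for x
    using hermitian[OF that] by (simp add: hermitian_form_def)
  have l0: "l x \<noteq> 0" if "x \<in> U" for x using l(2)[OF that] by simp
  have \<rho>: "smooth_on U (\<lambda>x. inverse (l x))" by (rule smooth_on_inverse[OF U l(1) l0])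
  have \<phi>d: "\<phi> differentiable (at x)" if "x \<in> U" for x by (rule smooth_on_differentiable[OF \<phi> that])
  have F1: "dir u F x = inverse (l x) *\<^sub>R cone_tangent (\<phi> x) (dir u \<phi> x) + dir u (\<lambda>x. inverse (l x)) x *\<^sub>R cone (\<phi> x)"
    if "x \<in> U" for u x
    unfolding F_def
    by (rule dir_eq) (intro has_derivative_scaleR has_derivative_cone \<phi>d has_derivative_dir smooth_on_differentiable[OF \<rho>] that)
  note lor = lorentz.add_left lorentz.add_right lorentz.scaleR_left lorentz.scaleR_right lorentz.diff_left
    lorentz.diff_right lorentz_cone
  have FF: "lorentz (F x) (F x) = 0" for x
    by (simp add: F_def lor)
  have FF1: "lorentz (F x) (dir u F x) = 0" if "x \<in> U" for u x
    by (simp add: F1[OF that]) (simp add: F_def lor)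
  have metric: "lorentz (dir u F x) (dir v F x) = g x u v" if "x \<in> U" for u v x
    unfolding F1[OF that] using l0[OF that] by (simp add: lor conf[OF that] power2_eq_square field_simps)
  have Fs: "smooth_on U F"
    unfolding F_def by (intro smooth_on_scaleR U \<rho> smooth_on_cone \<phi>)
  have frame: "\<exists>\<xi> \<zeta>. lorentz \<xi> \<xi> = 1 \<and> lorentz \<zeta> \<zeta> = 0 \<and> lorentz \<zeta> \<xi> = 0 \<and>
      lorentz \<xi> (F x) = 0 \<and> lorentz \<zeta> (F x) = 1 \<and> (\<forall>u. lorentz \<xi> (dir u F x) = 0) \<and> (\<forall>u. lorentz \<zeta> (dir u F x) = 0) \<and>
      (\<forall>z. lorentz z (F x) = 0 \<and> lorentz z \<xi> = 0 \<and> lorentz z \<zeta> = 0 \<and> (\<forall>u. lorentz z (dir u F x) = 0) \<longrightarrow> z = 0)"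
    if x: "x \<in> U" for x
  proof -
    interpret positive_form "g x" by (rule pos[OF x])
    have lin: "linear (\<lambda>u. dir u \<phi> x)" by (rule dir_linear[OF \<phi>d[OF x]])
    have "u = 0" if "dir u \<phi> x = 0" for u
      using conf[OF x, of u u] that g_pos[of u] l0[OF x] by auto
    then have inj: "inj (\<lambda>u. dir u \<phi> x)"
      using linear_injective_0[OF lin] by blast
    obtain \<nu> where \<nu>: "\<nu> \<bullet> \<nu> = 1" "\<And>u. dir u \<phi> x \<bullet> \<nu> = 0"
      "\<And>a. a \<bullet> \<nu> = 0 \<Longrightarrow> (\<And>u. a \<bullet> dir u \<phi> x = 0) \<Longrightarrow> a = 0"
      using unit_normal_exists[OF lin inj dim(2)] by blast
    define \<xi> where "\<xi> = cone_tangent (\<phi> x) \<nu>"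
    \<comment> \<open>A null vector orthogonal to \<open>\<xi>\<close>, scaled by \<open>l x\<close>
      to have product 1 with \<open>F x\<close>. Removing its tangential part
      \<open>dir a F x\<close> makes it normal, and a multiple of \<open>F x\<close> then makes it
      null again.\<close>
    define \<zeta>0 :: "'v \<times> real \<times> real" where "\<zeta>0 = (0, 0, - 2 * l x)"
    have "linear (\<lambda>u. dir u F x)"
      by (rule dir_linear[OF smooth_on_differentiable[OF Fs x]])
    then have "linear (\<lambda>u. lorentz \<zeta>0 (dir u F x))"
      using linear_compose[OF _ bounded_linear.linear[OF lorentz.bounded_linear_right]] by (simp add: o_def)
    then obtain a where a: "\<And>u. g x a u = lorentz \<zeta>0 (dir u F x)"
      using riesz by blast
    define \<zeta>1 where "\<zeta>1 = \<zeta>0 - dir a F x"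
    define \<zeta> where "\<zeta> = \<zeta>1 - (lorentz \<zeta>1 \<zeta>1 / 2) *\<^sub>R F x"
    have \<xi>: "lorentz \<xi> \<xi> = 1" "lorentz \<xi> (F x) = 0" "lorentz \<xi> (dir u F x) = 0" for u
      using \<nu>(1,2) by (simp_all add: F1[OF x] \<xi>_def F_def lor inner_commute)
    have 0: "lorentz \<zeta>0 (F x) = 1" "lorentz \<zeta>0 \<xi> = 0"
      using l0[OF x] by (simp_all add: \<zeta>0_def F_def \<xi>_def cone_def cone_tangent_def lorentz_def)
    have 1: "lorentz \<zeta>1 (F x) = 1" "lorentz \<zeta>1 \<xi> = 0" "lorentz \<zeta>1 (dir u F x) = 0" for u
      using 0 FF1[OF x, of a] \<xi>(3)[of a] metric[OF x, of a u] a[of u] lorentz_sym[of "dir a F x"]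
      by (simp_all add: \<zeta>1_def lor)
    have \<zeta>: "lorentz \<zeta> (F x) = 1" "lorentz \<zeta> \<xi> = 0" "lorentz \<zeta> (dir u F x) = 0" for u
      using 1 FF[of x] FF1[OF x] \<xi>(2) lorentz_sym[of "F x" \<xi>] by (simp_all add: \<zeta>_def lor)
    have \<zeta>\<zeta>: "lorentz \<zeta> \<zeta> = 0"
    proof -
      have "lorentz \<zeta> \<zeta> = lorentz \<zeta> \<zeta>1 - (lorentz \<zeta>1 \<zeta>1 / 2) * lorentz \<zeta> (F x)"
        by (subst (2) \<zeta>_def) (simp add: lor)
      also have "lorentz \<zeta> \<zeta>1 = lorentz \<zeta>1 \<zeta>1 - (lorentz \<zeta>1 \<zeta>1 / 2) * lorentz \<zeta>1 (F x)"
        by (subst \<zeta>_def) (simp add: lor lorentz_sym[of "F x"])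
      finally show ?thesis using \<zeta>(1) 1(1) by simp
    qed
    \<comment> \<open>The tangent and normal vectors of \<open>\<phi>\<close> give
      \<open>b = s *\<^sub>R \<phi> x\<close>, then \<open>\<zeta>0\<close> gives
      \<open>s = 0\<close>, and \<open>cone\<close> gives \<open>t = 0\<close>.\<close>
    have "z = 0" if z: "lorentz z (F x) = 0" "lorentz z \<xi> = 0" "lorentz z \<zeta> = 0" "\<And>u. lorentz z (dir u F x) = 0" for z
    proof -
      obtain b s t where zb: "z = (b, s, t)" by (metis prod_cases3)
      have c: "lorentz z (cone (\<phi> x)) = 0"
        using z(1) l0[OF x] by (simp add: F_def lor)
      have tan: "lorentz z (cone_tangent (\<phi> x) v) = (b - s *\<^sub>R \<phi> x) \<bullet> v" for v
        by (simp add: zb cone_tangent_def lorentz_Pair inner_diff_left)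
      have "b - s *\<^sub>R \<phi> x = 0"
      proof (rule \<nu>(3))
        show "(b - s *\<^sub>R \<phi> x) \<bullet> \<nu> = 0" using z(2) by (simp add: \<xi>_def tan)
        show "(b - s *\<^sub>R \<phi> x) \<bullet> dir u \<phi> x = 0" for u
          using z(4)[of u] l0[OF x] c by (simp add: F1[OF x] lor tan)
      qed
      then have b: "b = s *\<^sub>R \<phi> x" by simp
      have "lorentz z \<zeta>0 = 0"
        using z(1,3,4) by (simp add: \<zeta>_def \<zeta>1_def lor)
      then have "s = 0" using l0[OF x] by (simp add: zb \<zeta>0_def lorentz_Pair)
      moreover from this have "t = 0" using c b by (simp add: zb cone_def lorentz_Pair)
      ultimately show "z = 0" using b zb by (simp add: zero_prod_def)
    qed
    then show ?thesis
      using \<xi> \<zeta> \<zeta>\<zeta> by (intro exI[of _ \<xi>] exI[of _ \<zeta>]) blast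
  qed
  show ?thesis
    unfolding F_def[symmetric]
    by (intro light_cone_kaehler.intro flat_immersion.intro flat_immersion_axioms.intro
        light_cone_kaehler_axioms.intro bounded_bilinear_lorentz lorentz_sym U dim Fs pos metric hermitian J FF frame)
qed

section \<open>Inversions and scalings as isometric immersions\<close>

lemma isometric_immersionI:
  fixes g :: "'m::{t2_space, second_countable_topology} \<Rightarrow> 'v::euclidean_space"
  assumes "riemannian_metric A G" and g: "smooth_map A g" "has_conformal_factor A G g (\<lambda>_. 1)"
  shows "isometric_immersion A G g"
proof -
  have "inj (differential c g x)" if c: "c \<in> A" "x \<in> chart_image c" for c x
  proof -
    have "(g \<circ> chart_inv c) differentiable (at x)"
      using g(1) c smooth_on_differentiable unfolding smooth_map_def by blast
    then have lin: "linear (differential c g x)"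
      using dir_linear[of "g \<circ> chart_inv c" x] by (simp add: differential_def[abs_def] dir_def)
    have "u = 0" if "differential c g x u = 0" for u
      using g(2) c that assms(1) unfolding has_conformal_factor_def riemannian_metric_def
      by (metis inner_zero_left less_irrefl mult_1 power_one)
    then show ?thesis using linear_injective_0[OF lin] by blast
  qed
  then show ?thesis using g by (simp add: isometric_immersion_def immersion_def)
qed

lemma inversion_eq:
  "a + (k / (norm (y - a))\<^sup>2) *\<^sub>R (y - a) = a + (k * inverse ((y - a) \<bullet> (y - a))) *\<^sub>R (y - a)"
  by (simp add: power2_norm_eq_inner divide_inverse)

lemma smooth_on_inversion:
  fixes \<phi> :: "'e::euclidean_space \<Rightarrow> 'v::euclidean_space"
  assumes U: "open U" and \<phi>: "smooth_on U \<phi>" "\<And>y. y \<in> U \<Longrightarrow> \<phi> y \<noteq> a"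
  shows "smooth_on U (\<lambda>y. a + (k / (norm (\<phi> y - a))\<^sup>2) *\<^sub>R (\<phi> y - a))"
proof -
  have h: "smooth_on U (\<lambda>y. \<phi> y - a)"
    using smooth_on_add[OF U \<phi>(1) smooth_on_const[of U "- a"]] by simp
  show ?thesis
    unfolding inversion_eq using \<phi>(2)
    by (intro smooth_on_add smooth_on_const smooth_on_scaleR smooth_on_mult smooth_on_inverse
        smooth_on_inner U h) simp
qed

text \<open>Up to the factor \<open>k / |h|^2\<close>, the derivative of the inversion is the
  reflection in the hyperplane orthogonal to \<open>h\<close>, an isometry.\<close>

lemma inversion_conformal:
  fixes \<phi> :: "'e::euclidean_space \<Rightarrow> 'v::euclidean_space" and k :: real
  assumes U: "open U" "x \<in> U" and \<phi>: "smooth_on U \<phi>" "\<And>y. y \<in> U \<Longrightarrow> \<phi> y \<noteq> a"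
  defines "\<psi> \<equiv> \<lambda>y. a + (k / (norm (\<phi> y - a))\<^sup>2) *\<^sub>R (\<phi> y - a)"
  shows "dir u \<psi> x \<bullet> dir v \<psi> x = (k / (norm (\<phi> x - a))\<^sup>2)\<^sup>2 * (dir u \<phi> x \<bullet> dir v \<phi> x)"
proof -
  define h where "h y = \<phi> y - a" for y
  have h0: "h x \<bullet> h x \<noteq> 0" using \<phi>(2)[OF U(2)] by (simp add: h_def)
  have \<psi>: "\<psi> = (\<lambda>y. a + (k * inverse (h y \<bullet> h y)) *\<^sub>R h y)"
    unfolding \<psi>_def inversion_eq h_def ..
  have h': "(h has_derivative (\<lambda>u. dir u \<phi> x)) (at x)"
    unfolding h_def[abs_def]
    by (auto intro!: derivative_eq_intros has_derivative_dir smooth_on_differentiable[OF \<phi>(1) U(2)])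
  have d: "dir u h x = dir u \<phi> x" for u
    by (rule dir_eq[OF h'])
  have hd: "(h has_derivative (\<lambda>u. dir u h x)) (at x)"
    using h' by (simp add: d)
  let ?N = "h x \<bullet> h x"
  have inv: "((\<lambda>y. inverse (h y \<bullet> h y)) has_derivative
      (\<lambda>u. - (inverse ?N * (h x \<bullet> dir u h x + dir u h x \<bullet> h x) * inverse ?N))) (at x)"
    by (rule Deriv.has_derivative_inverse[OF h0 has_derivative_inner[OF hd hd]])
  have D: "dir u \<psi> x = (k * inverse ?N) *\<^sub>R dir u h x + (k * - (inverse ?N * (h x \<bullet> dir u h x + dir u h x \<bullet> h x) * inverse ?N)) *\<^sub>R h x" for u
    unfolding \<psi>
    by (rule dir_eq) (use has_derivative_add[OF has_derivative_const has_derivative_scaleR[OF has_derivative_mult_right[OF inv] hd], of a k] in simp)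
  have "dir u \<psi> x \<bullet> dir v \<psi> x = (k * inverse ?N)\<^sup>2 * (dir u h x \<bullet> dir v h x)"
    unfolding D using h0
    by (simp add: inner_simps inner_commute power2_eq_square divide_simps)
  then show "dir u \<psi> x \<bullet> dir v \<psi> x = (k / (norm (\<phi> x - a))\<^sup>2)\<^sup>2 * (dir u \<phi> x \<bullet> dir v \<phi> x)"
    unfolding d by (simp add: h_def power2_norm_eq_inner divide_inverse)
qed

section \<open>The conformal immersion theorem\<close>

lemma chart_inverse:
  assumes "smooth_atlas A" "c \<in> A"
  shows "x \<in> chart_image c \<Longrightarrow> chart_inv c x \<in> fst c" "x \<in> chart_image c \<Longrightarrow> snd c (chart_inv c x) = x"
    "p \<in> fst c \<Longrightarrow> snd c p \<in> chart_image c" "p \<in> fst c \<Longrightarrow> chart_inv c (snd c p) = p"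
  using assms unfolding smooth_atlas_def homeomorphism_def by blast+

lemma light_cone_chart:
  fixes A :: "('m::{t2_space, second_countable_topology}, 'e::euclidean_space) chart set"
    and f :: "'m \<Rightarrow> 'v::euclidean_space"
  assumes dim: "DIM('e) \<ge> 8" "DIM('v) = DIM('e) + 1" and K: "kaehler_manifold A G J"
    and f: "smooth_map A f" and l: "smooth_map A l" "\<forall>p\<in>carrier A. l p > 0" "has_conformal_factor A G f l"
    and c: "c \<in> A"
  shows "light_cone_kaehler lorentz (chart_image c) (G c)
    (\<lambda>x. inverse (l (chart_inv c x)) *\<^sub>R cone (f (chart_inv c x))) (J c)"
proof (rule light_cone_kaehler_lift[where \<phi> = "\<lambda>x. f (chart_inv c x)" and l = "\<lambda>x. l (chart_inv c x)", OF _ dim])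
  have atlas: "smooth_atlas A" using K by (simp add: kaehler_manifold_def)
  show "open (chart_image c)" using atlas c by (simp add: smooth_atlas_def)
  show "smooth_on (chart_image c) (\<lambda>x. f (chart_inv c x))" "smooth_on (chart_image c) (\<lambda>x. l (chart_inv c x))"
    using f l(1) c by (auto simp: smooth_map_def o_def)
  show "l (chart_inv c x) > 0" if "x \<in> chart_image c" for x
    using chart_inverse(1)[OF atlas c that] l(2) c by (auto simp: carrier_def)
  have R: "riemannian_metric A G" and C: "almost_complex_structure A J"
    using K by (simp_all add: kaehler_manifold_def)
  show "hermitian_form (G c x) (J c x)" if x: "x \<in> chart_image c" for x
  proof (intro hermitian_form.intro positive_form.intro hermitian_form_axioms.intro)
    show "bilinear (G c x)" "G c x u v = G c x v u" for u v
      using R c x unfolding riemannian_metric_def by blast+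
    show "G c x u u > 0" if "u \<noteq> 0" for u
      using R c x that unfolding riemannian_metric_def by blast
    show "linear (J c x)" "J c x (J c x u) = - u" for u
      using C c x unfolding almost_complex_structure_def by blast+
    show "G c x (J c x u) (J c x v) = G c x u v" for u v
      using K c x unfolding kaehler_manifold_def by blast
  qed
  show "smooth_on (chart_image c) (\<lambda>x. J c x u)" for u
    using C c unfolding almost_complex_structure_def by blast
  show "covariant_derivative_endo (G c) (J c) x u v = 0" if "x \<in> chart_image c" for x u v
    using K c that unfolding kaehler_manifold_def by blast
  show "dir u (\<lambda>x. f (chart_inv c x)) x \<bullet> dir v (\<lambda>x. f (chart_inv c x)) x = (l (chart_inv c x))\<^sup>2 * G c x u v"
    if "x \<in> chart_image c" for x u v
    using l(3) c that unfolding has_conformal_factor_def differential_def dir_def o_def by blast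
qed

text \<open>The image lies in an affine hyperplane section of the light cone orthogonal to a null vector,
  that is, in a flat model of Euclidean space.\<close>

lemma constant_isotropic_vector:
  fixes A :: "('m::{t2_space, second_countable_topology}, 'e::euclidean_space) chart set"
    and f :: "'m \<Rightarrow> 'v::euclidean_space"
  assumes dim: "DIM('e) \<ge> 8" "DIM('v) = DIM('e) + 1" and K: "kaehler_manifold A G J"
    and conn: "connected (carrier A)" and ne: "carrier A \<noteq> {}"
    and curved: "\<forall>p\<in>carrier A. \<not> flat_point A G p"
    and f: "smooth_map A f" and l: "smooth_map A l" "\<forall>p\<in>carrier A. l p > 0" "has_conformal_factor A G f l"
  obtains w where "lorentz w w = 0" "\<And>p. p \<in> carrier A \<Longrightarrow> lorentz w (cone (f p)) = l p"
proof -
  have atlas: "smooth_atlas A" using K by (simp add: kaehler_manifold_def)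
  note chart = light_cone_chart[OF dim K f l]
  define L where "L p = inverse (l p) *\<^sub>R cone (f p)" for p
  \<comment> \<open>Phrased on the manifold and without coordinates, so that solutions from
    different charts can be compared near a point.\<close>
  define near where "near w p \<longleftrightarrow> (\<exists>W. open W \<and> p \<in> W \<and> (\<forall>q\<in>W. q \<in> carrier A \<longrightarrow> lorentz w (L q) = 1))" for w p
  have curv: "\<exists>c\<in>A. p \<in> fst c \<and> (\<exists>u v w. curvature (G c) (snd c p) u v w \<noteq> 0)" if "p \<in> carrier A" for p
    using curved that unfolding flat_point_def by blast
  have ex: "\<exists>w. lorentz w w = 0 \<and> near w p" if p: "p \<in> carrier A" for p
  proof -
    obtain c u0 v0 w0 where c: "c \<in> A" "p \<in> fst c" "curvature (G c) (snd c p) u0 v0 w0 \<noteq> 0"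
      using curv[OF p] by blast
    interpret light_cone_kaehler lorentz "chart_image c" "G c"
      "\<lambda>x. inverse (l (chart_inv c x)) *\<^sub>R cone (f (chart_inv c x))" "J c"
      by (rule chart[OF c(1)])
    note inv = chart_inverse[OF atlas c(1)]
    obtain V w where V: "open V" "snd c p \<in> V" "V \<subseteq> chart_image c" "lorentz w w = 0"
      and w: "\<And>x. x \<in> V \<Longrightarrow> lorentz w (inverse (l (chart_inv c x)) *\<^sub>R cone (f (chart_inv c x))) = 1"
      using local_position[OF inv(3)[OF c(2)] c(3)] by blast
    have "open (fst c \<inter> snd c -` V)"
      using atlas c(1) V(1) unfolding smooth_atlas_def homeomorphism_def
      by (intro continuous_open_preimage) auto
    moreover have "lorentz w (L q) = 1" if "q \<in> fst c \<inter> snd c -` V" for q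
      using w[of "snd c q"] inv(4)[of q] that by (simp add: L_def)
    ultimately show ?thesis
      using V c(2) unfolding near_def by (intro exI[of _ w] conjI exI[of _ "fst c \<inter> snd c -` V"]) auto
  qed
  have unique: "w = w'" if p: "p \<in> carrier A" and nw: "near w p" and nw': "near w' p" for p w w'
  proof -
    obtain c u0 v0 w0 where c: "c \<in> A" "p \<in> fst c" "curvature (G c) (snd c p) u0 v0 w0 \<noteq> 0"
      using curv[OF p] by blast
    interpret light_cone_kaehler lorentz "chart_image c" "G c"
      "\<lambda>x. inverse (l (chart_inv c x)) *\<^sub>R cone (f (chart_inv c x))" "J c"
      by (rule chart[OF c(1)])
    note inv = chart_inverse[OF atlas c(1)]
    obtain W W' where W: "open W" "p \<in> W" "\<And>q. q \<in> W \<Longrightarrow> q \<in> carrier A \<Longrightarrow> lorentz w (L q) = 1"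
      and W': "open W'" "p \<in> W'" "\<And>q. q \<in> W' \<Longrightarrow> q \<in> carrier A \<Longrightarrow> lorentz w' (L q) = 1"
      using nw nw' unfolding near_def by blast
    let ?V = "chart_image c \<inter> chart_inv c -` (W \<inter> W')"
    have "open ?V"
      using atlas c(1) W(1) W'(1) unfolding smooth_atlas_def homeomorphism_def
      by (intro continuous_open_preimage) auto
    moreover have "snd c p \<in> ?V" using inv(3,4)[OF c(2)] W(2) W'(2) by simp
    moreover have "lorentz w (inverse (l (chart_inv c x)) *\<^sub>R cone (f (chart_inv c x))) = 1"
      "lorentz w' (inverse (l (chart_inv c x)) *\<^sub>R cone (f (chart_inv c x))) = 1" if "x \<in> ?V" for x
      using that W(3)[of "chart_inv c x"] W'(3)[of "chart_inv c x"] inv(1)[of x] c(1)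
      by (auto simp: L_def carrier_def)
    ultimately show ?thesis
      using local_position_unique[of ?V "snd c p" u0 v0 w0 w w'] c(3) by blast
  qed
  \<comment> \<open>The vector chosen at a point also works at all nearby points, where uniqueness
    identifies it with the one chosen there: \<open>N\<close> is locally constant.\<close>
  define N where "N p = (SOME w. lorentz w w = 0 \<and> near w p)" for p
  have N: "lorentz (N p) (N p) = 0" "near (N p) p" if "p \<in> carrier A" for p
    using someI_ex[OF ex[OF that]] unfolding N_def by blast+
  have "N constant_on carrier A"
  proof (rule locally_constant_imp_constant[OF conn])
    fix p assume p: "p \<in> carrier A"
    obtain W where W: "open W" "p \<in> W" "\<And>q. q \<in> W \<Longrightarrow> q \<in> carrier A \<Longrightarrow> lorentz (N p) (L q) = 1"
      using N(2)[OF p] unfolding near_def by blast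
    have "N q = N p" if "q \<in> carrier A \<inter> W" for q
    proof (rule unique)
      show "near (N p) q" unfolding near_def using W that by blast
    qed (use that N in auto)
    then show "\<exists>T. openin (top_of_set (carrier A)) T \<and> p \<in> T \<and> (\<forall>q\<in>T. N q = N p)"
      using openin_open_Int[OF W(1)] W(2) p by blast
  qed
  then obtain w where w: "\<And>p. p \<in> carrier A \<Longrightarrow> N p = w" unfolding constant_on_def by blast
  show thesis
  proof (rule that[of w])
    show "lorentz w w = 0" using ne N(1) w by (metis all_not_in_conv)
    fix p assume p: "p \<in> carrier A"
    then have "lorentz w (L p) = 1"
      using N(2)[OF p] w unfolding near_def by blast
    moreover have "l p > 0" using l(2) p by blast
    ultimately show "lorentz w (cone (f p)) = l p"
      by (simp add: L_def lorentz.scaleR_right field_simps)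
  qed
qed

text \<open>Concentric inversions of radii 1 and \<open>sqrt k\<close>; the origin goes to
  \<open>None\<close> and back, so the formula holds there too.\<close>

lemma moebius_scaling:
  assumes "k > 0"
  obtains \<tau> :: "'v::euclidean_space option \<Rightarrow> 'v option"
  where "moebius_transformation \<tau>" "\<And>x. \<tau> (Some x) = Some (k *\<^sub>R x)"
proof
  let ?t = "sphere_inversion (0::'v) (sqrt k) \<circ> (sphere_inversion 0 1 \<circ> id)"
  show "moebius_transformation ?t"
    using assms by (intro moebius_transformation.intros) auto
  show "?t (Some x) = Some (k *\<^sub>R x)" for x
    using assms by (simp add: sphere_inversion_def power_divide power2_eq_square)
qed

theorem theorem1:
  fixes n :: nat
    and A :: "('m::{t2_space, second_countable_topology}, 'e::euclidean_space) chart set"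
    and G :: "('m, 'e) metric_field"
    and J :: "('m, 'e) endo_field"
    and f :: "'m \<Rightarrow> 'v::euclidean_space"
  assumes "n \<ge> 4"
    and "DIM('e) = 2 * n"
    and "DIM('v) = 2 * n + 1"
    and "kaehler_manifold A G J"
    and "connected (carrier A)"
    and "simply_connected (carrier A)"
    and "\<forall>p\<in>carrier A. \<not> flat_point A G p"
    and "conformal_immersion A G f"
  shows "\<exists>(g :: 'm \<Rightarrow> 'v) \<tau>. isometric_immersion A G g \<and>
    moebius_transformation \<tau> \<and> (\<forall>p\<in>carrier A. \<tau> (Some (f p)) = Some (g p))"
proof -
  have dim: "DIM('e) \<ge> 8" "DIM('v) = DIM('e) + 1" using assms(1-3) by simp_all
  have atlas: "smooth_atlas A" and R: "riemannian_metric A G"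
    using assms(4) by (simp_all add: kaehler_manifold_def)
  obtain l where l: "smooth_map A l" "\<forall>p\<in>carrier A. l p > 0" "has_conformal_factor A G f l"
    and f: "smooth_map A f"
    using assms(8) by (auto simp: conformal_immersion_def immersion_def)
  have car: "chart_inv c x \<in> carrier A" if "c \<in> A" "x \<in> chart_image c" for c x
    using chart_inverse(1)[OF atlas that] that(1) by (auto simp: carrier_def)
  have op: "open (chart_image c)" if "c \<in> A" for c using atlas that by (simp add: smooth_atlas_def)
  have fs: "smooth_on (chart_image c) (f \<circ> chart_inv c)" if "c \<in> A" for c
    using f that by (simp add: smooth_map_def)
  have conf: "dir u (f \<circ> chart_inv c) x \<bullet> dir v (f \<circ> chart_inv c) x = (l (chart_inv c x))\<^sup>2 * G c x u v"
    if "c \<in> A" "x \<in> chart_image c" for c x u v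
    using l(3) that unfolding has_conformal_factor_def differential_def dir_def by blast
  have isoI: "isometric_immersion A G g"
    if "\<And>c. c \<in> A \<Longrightarrow> smooth_on (chart_image c) (g \<circ> chart_inv c)"
      "\<And>c x u v. c \<in> A \<Longrightarrow> x \<in> chart_image c \<Longrightarrow>
        dir u (g \<circ> chart_inv c) x \<bullet> dir v (g \<circ> chart_inv c) x = G c x u v" for g :: "'m \<Rightarrow> 'v"
    using that by (intro isometric_immersionI[OF R])
      (auto simp: smooth_map_def has_conformal_factor_def differential_def dir_def)
  have scaling: ?thesis if k: "k > 0" "\<And>p. p \<in> carrier A \<Longrightarrow> l p = k" for k
  proof -
    obtain \<tau> :: "'v option \<Rightarrow> 'v option" where \<tau>: "moebius_transformation \<tau>" "\<And>x. \<tau> (Some x) = Some (inverse k *\<^sub>R x)"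
      using moebius_scaling[of "inverse k"] k(1) by auto
    have eq: "(\<lambda>p. inverse k *\<^sub>R f p) \<circ> chart_inv c = (\<lambda>x. inverse k *\<^sub>R (f \<circ> chart_inv c) x)" for c
      by (simp add: fun_eq_iff)
    have "isometric_immersion A G (\<lambda>p. inverse k *\<^sub>R f p)"
    proof (rule isoI; unfold eq)
      show "smooth_on (chart_image c) (\<lambda>x. inverse k *\<^sub>R (f \<circ> chart_inv c) x)" if "c \<in> A" for c
        by (intro smooth_on_scaleR op smooth_on_const fs that)
      show "dir u (\<lambda>x. inverse k *\<^sub>R (f \<circ> chart_inv c) x) x \<bullet> dir v (\<lambda>x. inverse k *\<^sub>R (f \<circ> chart_inv c) x) x = G c x u v"
        if c: "c \<in> A" "x \<in> chart_image c" for c x u v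
        unfolding dir_bounded_linear[OF bounded_linear_scaleR_right smooth_on_differentiable[OF fs[OF c(1)] c(2)]]
        using k(1) k(2)[OF car[OF c]] conf[OF c, of u v] by (simp add: power2_eq_square field_simps)
    qed
    then show ?thesis using \<tau> by blast
  qed
  show ?thesis
  proof (cases "carrier A = {}")
    \<comment> \<open>Without points any positive constant will do.\<close>
    case True
    then show ?thesis using scaling[of 1] by simp
  next
    case False
    obtain w where w: "lorentz w w = 0" "\<And>p. p \<in> carrier A \<Longrightarrow> lorentz w (cone (f p)) = l p"
      using constant_isotropic_vector[OF dim assms(4,5) False assms(7) f l] by blast
    obtain a s t where w_eq: "w = (a, s, t)" by (metis prod_cases3)
    have null: "a \<bullet> a = s * t" using w(1) by (simp add: w_eq lorentz_Pair)
    have lp: "l p = a \<bullet> f p - (s * (f p \<bullet> f p) + t) / 2" if "p \<in> carrier A" for p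
      using w(2)[OF that] by (simp add: w_eq cone_def lorentz_Pair)
    obtain p0 where p0: "p0 \<in> carrier A" using False by blast
    show ?thesis
    proof (cases "s = 0")
      \<comment> \<open>Nullity \<open>a \<bullet> a = s * t\<close> gives \<open>a = 0\<close>, so
        the conformal factor is constant.\<close>
      case True
      then have "l p = - t / 2" if "p \<in> carrier A" for p
        using null lp[OF that] by simp
      then show ?thesis using scaling[of "- t / 2"] l(2) p0 by metis
    next
      case False
      \<comment> \<open>Completing the square in \<open>lp\<close>, with
        \<open>t = (a \<bullet> a) / s\<close>, gives centre \<open>b\<close> and coefficient
        \<open>k\<close>. Positivity of \<open>l\<close> yields \<open>k > 0\<close> and keeps
        \<open>f p\<close> away from \<open>b\<close>, so the inversion is defined on the
        image.\<close>
      define b where "b = (1 / s) *\<^sub>R a"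
      define k where "k = - s / 2"
      have lk: "l p = k * (norm (f p - b))\<^sup>2" if "p \<in> carrier A" for p
        unfolding lp[OF that] power2_norm_eq_inner b_def k_def using False
        by (simp add: inner_diff_left inner_diff_right null inner_commute field_simps)
      have k: "k > 0"
        using lk[OF p0] l(2) p0 by (metis zero_less_mult_iff zero_le_power2 not_less)
      have ne: "f p \<noteq> b" if "p \<in> carrier A" for p
        using lk[OF that] l(2) that by force
      \<comment> \<open>The squared radius \<open>inverse k\<close> makes the inversion scale by
        \<open>1 / l p\<close> at \<open>f p\<close>, which undoes the conformal factor of
        \<open>f\<close>.\<close>
      define g where "g p = b + (inverse k / (norm (f p - b))\<^sup>2) *\<^sub>R (f p - b)" for p
      have eq: "g \<circ> chart_inv c = (\<lambda>x. b + (inverse k / (norm ((f \<circ> chart_inv c) x - b))\<^sup>2) *\<^sub>R ((f \<circ> chart_inv c) x - b))" for c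
        by (simp add: fun_eq_iff g_def)
      have "isometric_immersion A G g"
      proof (rule isoI)
        fix c assume c: "c \<in> A"
        have ne': "(f \<circ> chart_inv c) y \<noteq> b" if "y \<in> chart_image c" for y
          using ne[OF car[OF c that]] by simp
        show "smooth_on (chart_image c) (g \<circ> chart_inv c)"
          unfolding eq by (rule smooth_on_inversion[OF op[OF c] fs[OF c] ne'])
        fix x u v assume x: "x \<in> chart_image c"
        have "dir u (g \<circ> chart_inv c) x \<bullet> dir v (g \<circ> chart_inv c) x
          = (inverse k / (norm ((f \<circ> chart_inv c) x - b))\<^sup>2)\<^sup>2 * ((l (chart_inv c x))\<^sup>2 * G c x u v)"
          using inversion_conformal[where \<phi> = "f \<circ> chart_inv c" and a = b and k = "inverse k",
              OF op[OF c] x fs[OF c] ne', of u v]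
          unfolding eq conf[OF c x] .
        also have "\<dots> = G c x u v"
          using k ne'[OF x] lk[OF car[OF c x]] by (simp add: power_mult_distrib power_divide power_inverse)
        finally show "dir u (g \<circ> chart_inv c) x \<bullet> dir v (g \<circ> chart_inv c) x = G c x u v" .
      qed
      moreover have "moebius_transformation (sphere_inversion b (sqrt (inverse k)) \<circ> id)"
        using k by (intro moebius_transformation.intros) simp
      moreover have "(sphere_inversion b (sqrt (inverse k)) \<circ> id) (Some (f p)) = Some (g p)" if "p \<in> carrier A" for p
        using ne[OF that] k by (simp add: sphere_inversion_def g_def)
      ultimately show ?thesis by blast
    qed
  qed
qed

end
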